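(* Let $k\ge 1$ be an integer and let $G$ be a simple planar graph of order $n$ with maximum degree $n-1$ which does not contain $k$ pairwise edge-disjoint cycles. Then $e(G)\le n+3k-4$, with equality if and only if $G\cong K_1\nabla H$, where $H$ is a graph on $n-1$ vertices with $t(H)=k-1$ and every non-trivial connected component of $H$ is a triangle-cactus.
   Context: All graphs are finite and simple. $e(G)$ is the number of edges and $t(H)$ the number of triangles of a graph. A block is a maximal connected subgraph without cut vertices. A triangle-cactus is a connected graph each of whose blocks is a triangle. For vertex-disjoint graphs $G_1,G_2$, the join $G_1\nabla G_2$ is obtained from their disjoint union by joining every vertex of $G_1$ to every vertex of $G_2$. A non-trivial component is a component with at least one edge. *)

theory Defs
  imports "HOL-Analysis.Analysis"
begin

definition simple_graph :: "'a set \<Rightarrow> 'a set set \<Rightarrow> bool" where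
  "simple_graph V E \<longleftrightarrow> finite V \<and> (\<forall>e\<in>E. e \<subseteq> V \<and> card e = 2)"

definition degree :: "'a set \<Rightarrow> 'a set set \<Rightarrow> 'a \<Rightarrow> nat" where
  "degree V E v = card {u\<in>V. {u, v} \<in> E}"

definition max_degree :: "'a set \<Rightarrow> 'a set set \<Rightarrow> nat" where
  "max_degree V E = Max (degree V E ` V)"

definition planar :: "'a set \<Rightarrow> 'a set set \<Rightarrow> bool" where
  "planar V E \<longleftrightarrow> (\<exists>(f :: 'a \<Rightarrow> complex) (\<gamma> :: 'a set \<Rightarrow> real \<Rightarrow> complex).
     inj_on f V \<and>
     (\<forall>e\<in>E. arc (\<gamma> e) \<and>
        (\<exists>u v. e = {u, v} \<and> pathstart (\<gamma> e) = f u \<and> pathfinish (\<gamma> e) = f v) \<and>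
        path_image (\<gamma> e) \<inter> f ` V = f ` e) \<and>
     (\<forall>e\<in>E. \<forall>e'\<in>E. e \<noteq> e' \<longrightarrow> path_image (\<gamma> e) \<inter> path_image (\<gamma> e') = f ` (e \<inter> e')))"

definition cycle_edges :: "'a list \<Rightarrow> 'a set set" where
  "cycle_edges c = {{c ! i, c ! ((i + 1) mod length c)} | i. i < length c}"

definition is_cycle :: "'a set \<Rightarrow> 'a set set \<Rightarrow> 'a list \<Rightarrow> bool" where
  "is_cycle V E c \<longleftrightarrow> length c \<ge> 3 \<and> distinct c \<and> set c \<subseteq> V \<and> cycle_edges c \<subseteq> E"

definition has_k_edge_disjoint_cycles :: "'a set \<Rightarrow> 'a set set \<Rightarrow> nat \<Rightarrow> bool" where
  "has_k_edge_disjoint_cycles V E k \<longleftrightarrow>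
     (\<exists>C :: nat \<Rightarrow> 'a list. (\<forall>i<k. is_cycle V E (C i)) \<and>
        (\<forall>i<k. \<forall>j<k. i \<noteq> j \<longrightarrow> cycle_edges (C i) \<inter> cycle_edges (C j) = {}))"

definition triangles :: "'a set \<Rightarrow> 'a set set \<Rightarrow> 'a set set" where
  "triangles V E = {T. T \<subseteq> V \<and> card T = 3 \<and> (\<forall>x\<in>T. \<forall>y\<in>T. x \<noteq> y \<longrightarrow> {x, y} \<in> E)}"

definition num_triangles :: "'a set \<Rightarrow> 'a set set \<Rightarrow> nat" where
  "num_triangles V E = card (triangles V E)"

definition reach :: "'a set \<Rightarrow> 'a set set \<Rightarrow> 'a \<Rightarrow> 'a \<Rightarrow> bool" where
  "reach W F = (\<lambda>x y. x \<in> W \<and> y \<in> W \<and> {x, y} \<in> F)\<^sup>*\<^sup>*"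

definition connected_graph :: "'a set \<Rightarrow> 'a set set \<Rightarrow> bool" where
  "connected_graph W F \<longleftrightarrow> W \<noteq> {} \<and> (\<forall>x\<in>W. \<forall>y\<in>W. reach W F x y)"

definition subgraph :: "'a set \<Rightarrow> 'a set set \<Rightarrow> 'a set \<Rightarrow> 'a set set \<Rightarrow> bool" where
  "subgraph W F V E \<longleftrightarrow> W \<subseteq> V \<and> F \<subseteq> E \<and> (\<forall>e\<in>F. e \<subseteq> W)"

text \<open>x is a cut vertex of the (connected) graph (W,F): deleting x disconnects two remaining vertices.\<close>

definition cut_vertex :: "'a set \<Rightarrow> 'a set set \<Rightarrow> 'a \<Rightarrow> bool" where
  "cut_vertex W F x \<longleftrightarrow> x \<in> W \<and>
     (\<exists>u\<in>W - {x}. \<exists>w\<in>W - {x}. \<not> reach (W - {x}) {e\<in>F. x \<notin> e} u w)"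

definition block :: "'a set \<Rightarrow> 'a set set \<Rightarrow> 'a set \<Rightarrow> 'a set set \<Rightarrow> bool" where
  "block V E W F \<longleftrightarrow>
     subgraph W F V E \<and> connected_graph W F \<and> (\<forall>x. \<not> cut_vertex W F x) \<and>
     (\<forall>W' F'. subgraph W' F' V E \<and> connected_graph W' F' \<and> (\<forall>x. \<not> cut_vertex W' F' x) \<and>
        W \<subseteq> W' \<and> F \<subseteq> F' \<longrightarrow> W' = W \<and> F' = F)"

definition is_triangle :: "'a set \<Rightarrow> 'a set set \<Rightarrow> bool" where
  "is_triangle W F \<longleftrightarrow> card W = 3 \<and> F = {{x, y} | x y. x \<in> W \<and> y \<in> W \<and> x \<noteq> y}"

definition triangle_cactus :: "'a set \<Rightarrow> 'a set set \<Rightarrow> bool" where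
  "triangle_cactus V E \<longleftrightarrow> connected_graph V E \<and> (\<forall>W F. block V E W F \<longrightarrow> is_triangle W F)"

definition components :: "'a set \<Rightarrow> 'a set set \<Rightarrow> 'a set set" where
  "components V E = {{y\<in>V. reach V E x y} | x. x \<in> V}"

definition induced_edges :: "'a set set \<Rightarrow> 'a set \<Rightarrow> 'a set set" where
  "induced_edges E C = {e\<in>E. e \<subseteq> C}"

definition nontrivial_components_triangle_cacti :: "'a set \<Rightarrow> 'a set set \<Rightarrow> bool" where
  "nontrivial_components_triangle_cacti V E \<longleftrightarrow>
     (\<forall>C\<in>components V E. induced_edges E C \<noteq> {} \<longrightarrow> triangle_cactus C (induced_edges E C))"

text \<open>G is isomorphic to K_1 join H, with H the graph G - v.\<close>

definition delete_vertex_edges :: "'a set set \<Rightarrow> 'a \<Rightarrow> 'a set set" where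
  "delete_vertex_edges E v = {e\<in>E. v \<notin> e}"

end

theory Submission
  imports Defs
begin

text \<open>
  Let \<open>v\<close> be a dominating vertex of \<open>G\<close> and \<open>H = G - v\<close>; the claim is \<open>e(H) \<le> 3 (k - 1)\<close>.
  As \<open>G\<close> is planar, \<open>H\<close> has no theta, that is, no three internally disjoint paths between two
  vertices each with an inner vertex: joined to \<open>v\<close> these would give a subdivided
  \<open>K\<^bsub>3,3\<^esub>\<close>, which Janiszewski's theorem excludes.
  Delete edge-disjoint triangles from \<open>H\<close> as long as possible; each costs three edges and is one
  cycle. A component on \<open>m \<ge> 2\<close> vertices of the triangle-free rest has at most \<open>(3 m - 4) / 2\<close>
  edges, and pairing its vertices along short paths through \<open>v\<close> yields \<open>m div 2\<close> edge-disjoint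
  cycles, which is more than a third of the number of edges.
  So in the extremal case \<open>H\<close> is an edge-disjoint union of \<open>k - 1\<close> triangles. If some cycle of \<open>H\<close>
  were not one of them, a shortest such cycle \<open>c\<close> would meet \<open>length c\<close> distinct triangles of the
  partition with distinct third vertices off \<open>c\<close>; replacing these triangles by \<open>c\<close> and by the
  triangles spanned by \<open>v\<close>, a vertex of \<open>c\<close> and a third vertex gains one cycle. Hence all cycles
  of \<open>H\<close> are triangles of the partition, and the blocks are exactly these triangles.
\<close>

section \<open>Planarity excludes thetas\<close>

lemma connected_subset_open_disjoint:
  assumes "connected S" "open A" "open B" "A \<inter> B = {}" "S \<subseteq> A \<union> B" "x \<in> S" "x \<in> A"
  shows "S \<subseteq> A"
  using connectedD[OF assms(1,2,3)] assms by blast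

text \<open>The arcs \<open>g1\<close> and \<open>g2\<close> form a Jordan curve \<open>J\<close>.
  The third arc is tied to \<open>w\<close> by its spoke, so it stays on the side of
  \<open>J\<close> that contains \<open>w\<close>. A point \<open>d\<close> of the other side
  reaches \<open>w\<close> across the foot \<open>x2\<close> while avoiding arcs 1 and 3, and across
  \<open>x1\<close> while avoiding arcs 2 and 3. These two obstacles meet in the connected third
  arc, so Janiszewski's theorem joins \<open>d\<close> to \<open>w\<close> off \<open>J\<close>,
  which is absurd.\<close>

lemma no_planar_K33:
  fixes g1 g2 g3 :: "real \<Rightarrow> complex"
  assumes arcs: "arc g1" "arc g2" "arc g3"
    and ends: "pathstart g1 = \<alpha>" "pathstart g2 = \<alpha>" "pathstart g3 = \<alpha>"
      "pathfinish g1 = \<beta>" "pathfinish g2 = \<beta>" "pathfinish g3 = \<beta>"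
    and meet: "path_image g1 \<inter> path_image g2 \<subseteq> {\<alpha>, \<beta>}"
      "path_image g1 \<inter> path_image g3 \<subseteq> {\<alpha>, \<beta>}" "path_image g2 \<inter> path_image g3 \<subseteq> {\<alpha>, \<beta>}"
    and spokes: "connected R1" "connected R2" "connected R3" "w \<in> R1" "w \<in> R2" "w \<in> R3"
      "x1 \<in> R1" "x2 \<in> R2" "x3 \<in> R3"
    and feet: "x1 \<in> path_image g1 - {\<alpha>, \<beta>}" "x2 \<in> path_image g2 - {\<alpha>, \<beta>}"
      "x3 \<in> path_image g3 - {\<alpha>, \<beta>}"
    and touch: "R1 \<inter> (path_image g1 \<union> path_image g2 \<union> path_image g3) \<subseteq> {x1}"
      "R2 \<inter> (path_image g1 \<union> path_image g2 \<union> path_image g3) \<subseteq> {x2}"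
      "R3 \<inter> (path_image g1 \<union> path_image g2 \<union> path_image g3) \<subseteq> {x3}"
  shows False
proof -
  define A1 A2 A3 J where "A1 = path_image g1" and "A2 = path_image g2" and "A3 = path_image g3"
    and "J = path_image g1 \<union> path_image g2"
  have \<alpha>\<beta>: "\<alpha> \<in> A1" "\<beta> \<in> A1" "\<alpha> \<in> A2" "\<beta> \<in> A2" "\<alpha> \<in> A3" "\<beta> \<in> A3"
    unfolding A1_def A2_def A3_def using ends pathstart_in_path_image pathfinish_in_path_image by metis+
  define c where "c = g1 +++ reversepath g2"
  have c: "simple_path c" "pathfinish c = pathstart c" "path_image c = J"
    using arcs ends meet unfolding c_def J_def
    by (auto intro!: simple_path_join_loop simp: arc_reversepath path_image_join)
  \<comment> \<open>On \<open>J\<close>, the vertex \<open>w\<close> would have to coincide with all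
    three feet, but these lie on different arcs away from the common ends.\<close>
  have wJ: "w \<notin> J"
    using spokes feet touch meet unfolding J_def by blast
  \<comment> \<open>\<open>D\<close> is whichever side of \<open>J\<close> contains
    \<open>w\<close>, be it the bounded or the unbounded one.\<close>
  obtain D D' where D: "open D" "open D'" "connected D'" "D \<inter> D' = {}" "D \<union> D' = - J" "w \<in> D"
    "D' \<noteq> {}" "frontier D' = J"
  proof -
    obtain I O' where "I \<noteq> {}" "open I" "connected I" "O' \<noteq> {}" "open O'" "connected O'"
      "I \<inter> O' = {}" "I \<union> O' = - J" "frontier I = J" "frontier O' = J"
      using Jordan_curve[OF c(1,2)] unfolding c(3) by metis
    then show thesis using that[of I O'] that[of O' I] wJ by blast
  qed
  obtain d where d: "d \<in> D'" using D by blast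
  \<comment> \<open>The open third arc together with its spoke is connected, contains
    \<open>w\<close> and misses \<open>J\<close>.\<close>
  have "connected (A3 - {\<alpha>, \<beta>})"
    using connected_simple_path_endless[of g3] arcs ends arc_imp_simple_path by (auto simp: A3_def)
  then have "connected (R3 \<union> (A3 - {\<alpha>, \<beta>}))"
    using spokes feet by (intro connected_Un) (auto simp: A3_def)
  moreover have "R3 \<union> (A3 - {\<alpha>, \<beta>}) \<subseteq> D \<union> D'"
    unfolding D using meet touch feet unfolding A3_def J_def by blast
  ultimately have "R3 \<union> (A3 - {\<alpha>, \<beta>}) \<subseteq> D"
    using connected_subset_open_disjoint D spokes by (metis UnI1)
  then have A3D': "A3 \<inter> D' = {}" using D \<alpha>\<beta> unfolding J_def A1_def by blast
  \<comment> \<open>\<open>S\<close> is an obstacle made of arcs, \<open>R\<close> a spoke whose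
    foot \<open>x\<close> is on \<open>J\<close> but off \<open>S\<close>. As \<open>x\<close>
    belongs to the frontier of \<open>D'\<close>, the set \<open>insert x D'\<close> is still
    connected, and the spoke leads on to \<open>w\<close>.\<close>
  have unseparated: "connected_component (- S) d w"
    if "connected R" "x \<in> R" "w \<in> R" "x \<in> J" "S \<inter> R \<subseteq> {x}" "x \<notin> S" "S \<subseteq> J \<union> A3" for S R x
  proof (rule connected_componentI)
    have "connected (insert x D')"
      by (rule connected_intermediate_closure[OF D(3)]) (use that D closure_Un_frontier[of D'] in blast)+
    then show "connected (insert x D' \<union> R)"
      using that by (intro connected_Un) auto
    show "insert x D' \<union> R \<subseteq> - S" using that D A3D' by blast
  qed (use d that in auto)
  have "connected_component (- (A1 \<union> A3)) d w"
    by (rule unseparated[of R2 x2]) (use spokes feet touch meet in \<open>auto simp: J_def A1_def A3_def\<close>)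
  moreover have "connected_component (- (A2 \<union> A3)) d w"
    by (rule unseparated[of R1 x1]) (use spokes feet touch meet in \<open>auto simp: J_def A2_def A3_def\<close>)
  moreover have "(A1 \<union> A3) \<inter> (A2 \<union> A3) = A3"
    using meet \<alpha>\<beta> unfolding A1_def A2_def A3_def by blast
  moreover have "connected A3" "compact (A1 \<union> A3)" "closed (A2 \<union> A3)"
    using arcs by (auto simp: A1_def A2_def A3_def connected_arc_image compact_arc_image compact_Un closed_Un closed_arc_image)
  ultimately have "connected_component (- ((A1 \<union> A3) \<union> (A2 \<union> A3))) d w"
    using Janiszewski by metis
  then obtain T where T: "connected T" "T \<subseteq> - J" "d \<in> T" "w \<in> T"
    unfolding connected_component_def J_def A1_def A2_def by blast
  then have "T \<subseteq> D" using connected_subset_open_disjoint[OF T(1) D(1,2,4)] D by blast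
  then show False using T d D by blast
qed

section \<open>Walks as vertex lists and their drawings\<close>

definition adj_walk :: "'a set set \<Rightarrow> 'a list \<Rightarrow> bool" where
  "adj_walk E = successively (\<lambda>x y. {x, y} \<in> E)"

fun path_edges :: "'a list \<Rightarrow> 'a set set" where
  "path_edges (x # y # xs) = insert {x, y} (path_edges (y # xs))"
| "path_edges _ = {}"

text \<open>Every path needs an inner vertex to carry a spoke: together with an apex
  \<open>v\<close>, the sides of the subdivided K_3,3 are \<open>a\<close>, \<open>b\<close>,
  \<open>v\<close> and one inner vertex of each path.\<close>

definition theta_free :: "'a set set \<Rightarrow> bool" where
  "theta_free E \<longleftrightarrow> \<not> (\<exists>a b p q r. p \<noteq> [] \<and> q \<noteq> [] \<and> r \<noteq> [] \<and> distinct (a # b # p @ q @ r) \<and>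
     adj_walk E (a # p @ [b]) \<and> adj_walk E (a # q @ [b]) \<and> adj_walk E (a # r @ [b]))"

lemma adj_walk_simps [simp]:
  "adj_walk E []" "adj_walk E [x]" "adj_walk E (x # y # xs) \<longleftrightarrow> {x, y} \<in> E \<and> adj_walk E (y # xs)"
  by (auto simp: adj_walk_def)

lemma adj_walk_Cons: "adj_walk E (x # xs) \<longleftrightarrow> xs = [] \<or> {x, hd xs} \<in> E \<and> adj_walk E xs"
  by (auto simp: adj_walk_def successively_Cons)

lemma adj_walk_append:
  "adj_walk E (xs @ ys) \<longleftrightarrow>
     adj_walk E xs \<and> adj_walk E ys \<and> (xs = [] \<or> ys = [] \<or> {last xs, hd ys} \<in> E)"
  by (auto simp: adj_walk_def successively_append_iff)

lemma adj_walk_rev [simp]: "adj_walk E (rev xs) \<longleftrightarrow> adj_walk E xs"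
  by (auto simp: adj_walk_def insert_commute)

lemma adj_walk_iff_path_edges: "adj_walk E xs \<longleftrightarrow> path_edges xs \<subseteq> E"
  by (induction xs rule: path_edges.induct) auto

lemma path_edges_vertices: "e \<in> path_edges xs \<Longrightarrow> e \<subseteq> set xs"
  by (induction xs rule: path_edges.induct) auto

lemma path_edges_card: "distinct xs \<Longrightarrow> e \<in> path_edges xs \<Longrightarrow> card e = 2"
  by (induction xs rule: path_edges.induct) auto

lemma path_edges_cover: "x \<in> set xs \<Longrightarrow> 2 \<le> length xs \<Longrightarrow> \<exists>e\<in>path_edges xs. x \<in> e"
proof (induction xs rule: path_edges.induct)
  case (1 x y xs) then show ?case by (cases xs) auto
qed auto

text \<open>The arcs of successive edges are joined one by one; distinctness of the vertices keeps
  the concatenation injective.\<close>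

lemma arc_of_path:
  fixes f :: "'a \<Rightarrow> complex" and \<gamma> :: "'a set \<Rightarrow> real \<Rightarrow> complex"
  assumes inj: "inj_on f V"
    and edges: "\<And>e. e \<in> E \<Longrightarrow> arc (\<gamma> e) \<and>
        (\<exists>u v. e = {u, v} \<and> pathstart (\<gamma> e) = f u \<and> pathfinish (\<gamma> e) = f v) \<and>
        path_image (\<gamma> e) \<inter> f ` V = f ` e"
    and cross: "\<And>e e'. e \<in> E \<Longrightarrow> e' \<in> E \<Longrightarrow> e \<noteq> e' \<Longrightarrow>
        path_image (\<gamma> e) \<inter> path_image (\<gamma> e') = f ` (e \<inter> e')"
    and "adj_walk E xs" "distinct xs" "2 \<le> length xs" "set xs \<subseteq> V"
  shows "\<exists>g. arc g \<and> pathstart g = f (hd xs) \<and> pathfinish g = f (last xs) \<and>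
     path_image g = (\<Union>e\<in>path_edges xs. path_image (\<gamma> e))"
  using assms(4-7)
proof (induction xs rule: path_edges.induct)
  case (1 x y xs)
  \<comment> \<open>The drawing orients each edge arbitrarily, so its arc may have to be
    reversed.\<close>
  have edge: "\<exists>g. arc g \<and> pathstart g = f x \<and> pathfinish g = f y \<and> path_image g = path_image (\<gamma> {x, y})"
  proof -
    have "{x, y} \<in> E" using 1 by simp
    then obtain u v where uv: "{x, y} = {u, v}" "pathstart (\<gamma> {x, y}) = f u" "pathfinish (\<gamma> {x, y}) = f v"
      and arc: "arc (\<gamma> {x, y})" using edges by metis
    from uv(1) consider "u = x" "v = y" | "u = y" "v = x" by (auto simp: doubleton_eq_iff)
    then show ?thesis
    proof cases
      case 1 then show ?thesis using uv arc by (intro exI[of _ "\<gamma> {x, y}"]) auto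
    next
      case 2 then show ?thesis using uv arc
        by (intro exI[of _ "reversepath (\<gamma> {x, y})"]) (auto simp: arc_reversepath)
    qed
  qed
  then obtain g1 where g1: "arc g1" "pathstart g1 = f x" "pathfinish g1 = f y"
    "path_image g1 = path_image (\<gamma> {x, y})" by blast
  show ?case
  proof (cases xs)
    case Nil then show ?thesis using g1 by auto
  next
    case (Cons z zs)
    then obtain g2 where g2: "arc g2" "pathstart g2 = f y" "pathfinish g2 = f (last (y # xs))"
      "path_image g2 = (\<Union>e\<in>path_edges (y # xs). path_image (\<gamma> e))"
      using 1 by auto
    \<comment> \<open>The vertex \<open>x\<close> is on no later edge, hence the first edge can
      share only \<open>y\<close> with any of them.\<close>
    have "path_image (\<gamma> {x, y}) \<inter> path_image (\<gamma> e) \<subseteq> {f y}" if e: "e \<in> path_edges (y # xs)" for e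
    proof -
      have "e \<subseteq> set (y # xs)" using e path_edges_vertices by blast
      moreover have "e \<in> E" "{x, y} \<in> E" using e 1(2) by (auto simp: adj_walk_iff_path_edges)
      moreover have "x \<notin> e" using calculation 1(3) by auto
      ultimately show ?thesis using cross[of "{x, y}" e] by auto
    qed
    then have "path_image g1 \<inter> path_image g2 \<subseteq> {pathstart g2}"
      unfolding g1 g2 by blast
    then have "arc (g1 +++ g2)" using g1 g2 by (intro arc_join) auto
    then show ?thesis using g1 g2 by (intro exI[of _ "g1 +++ g2"]) (auto simp: path_image_join)
  qed
qed auto

text \<open>The three paths of a theta are drawn as arcs from \<open>f a\<close> to
  \<open>f b\<close>, and the edges joining \<open>v\<close> to an inner vertex of each path serve
  as the spokes of \<open>no_planar_K33\<close>.\<close>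

lemma theta_free_if_planar_apex:
  assumes "planar V E" and simple: "\<forall>e\<in>E. e \<subseteq> V \<and> card e = 2"
    and dom: "\<And>u. u \<in> V - {v} \<Longrightarrow> {u, v} \<in> E" and v: "v \<in> V"
  shows "theta_free {e\<in>E. v \<notin> e}"
  unfolding theta_free_def
proof safe
  fix a b p q r
  let ?F = "{e\<in>E. v \<notin> e}"
  assume ne: "p \<noteq> []" "q \<noteq> []" "r \<noteq> []" and dist: "distinct (a # b # p @ q @ r)"
    and walks: "adj_walk ?F (a # p @ [b])" "adj_walk ?F (a # q @ [b])" "adj_walk ?F (a # r @ [b])"
  obtain f :: "'a \<Rightarrow> complex" and \<gamma> where inj: "inj_on f V"
    and edges: "\<And>e. e \<in> E \<Longrightarrow> arc (\<gamma> e) \<and>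
        (\<exists>u v. e = {u, v} \<and> pathstart (\<gamma> e) = f u \<and> pathfinish (\<gamma> e) = f v) \<and>
        path_image (\<gamma> e) \<inter> f ` V = f ` e"
    and cross: "\<And>e e'. e \<in> E \<Longrightarrow> e' \<in> E \<Longrightarrow> e \<noteq> e' \<Longrightarrow>
        path_image (\<gamma> e) \<inter> path_image (\<gamma> e') = f ` (e \<inter> e')"
    using assms(1) unfolding planar_def by metis
  define I where "I = (\<lambda>xs. \<Union>e\<in>path_edges (a # xs @ [b]). path_image (\<gamma> e))"
  have sub: "set (a # xs @ [b]) \<subseteq> V - {v}" if "adj_walk ?F (a # xs @ [b])" for xs
  proof
    fix x assume "x \<in> set (a # xs @ [b])"
    then obtain e where "e \<in> path_edges (a # xs @ [b])" "x \<in> e"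
      using path_edges_cover[of x "a # xs @ [b]"] by auto
    then show "x \<in> V - {v}" using that simple by (auto simp: adj_walk_iff_path_edges)
  qed
  have arc: "\<exists>g. arc g \<and> pathstart g = f a \<and> pathfinish g = f b \<and> path_image g = I xs"
    if "adj_walk ?F (a # xs @ [b])" "distinct (a # xs @ [b])" for xs
  proof -
    have "adj_walk E (a # xs @ [b])" using that(1) by (auto simp: adj_walk_iff_path_edges)
    then show ?thesis
      using arc_of_path[OF inj edges cross, of E "a # xs @ [b]"] that sub[OF that(1)]
      unfolding I_def by auto
  qed
  have meet: "I xs \<inter> I ys \<subseteq> {f a, f b}"
    if "adj_walk ?F (a # xs @ [b])" "adj_walk ?F (a # ys @ [b])" "set xs \<inter> set ys = {}"
      "distinct (a # xs @ [b])" "xs \<noteq> []" for xs ys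
  proof -
    have "path_image (\<gamma> e) \<inter> path_image (\<gamma> e') \<subseteq> {f a, f b}"
      if e: "e \<in> path_edges (a # xs @ [b])" "e' \<in> path_edges (a # ys @ [b])" for e e'
    proof -
      have sub: "e \<subseteq> set (a # xs @ [b])" "e' \<subseteq> set (a # ys @ [b])"
        using e path_edges_vertices by blast+
      then have "e \<inter> e' \<subseteq> {a, b}" using that \<open>set xs \<inter> set ys = {}\<close> by auto
      \<comment> \<open>An edge common to both paths could only be \<open>{a, b}\<close>, which a
        path with distinct vertices and an inner vertex does not use.\<close>
      moreover have "e \<noteq> e'"
      proof
        assume "e = e'"
        then have "e \<subseteq> {a, b}" using \<open>e \<inter> e' \<subseteq> {a, b}\<close> by auto
        moreover have "card e = 2" using e \<open>distinct (a # xs @ [b])\<close> path_edges_card by blast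
        moreover have "card {a, b} = 2" using dist by auto
        ultimately have "e = {a, b}" by (intro card_subset_eq) auto
        then show False using e(1) \<open>distinct (a # xs @ [b])\<close> \<open>xs \<noteq> []\<close>
        proof (cases xs)
          case (Cons z zs)
          then have "{a, b} \<noteq> {a, z}" using \<open>distinct (a # xs @ [b])\<close> by (auto simp: doubleton_eq_iff)
          moreover have "a \<notin> set (xs @ [b])" using \<open>distinct (a # xs @ [b])\<close> by auto
          ultimately show False using e(1) Cons \<open>e = {a, b}\<close> path_edges_vertices[of e "xs @ [b]"] by auto
        qed auto
      qed
      moreover have "e \<in> E" "e' \<in> E" using e \<open>adj_walk ?F (a # xs @ [b])\<close> \<open>adj_walk ?F (a # ys @ [b])\<close>
        by (auto simp: adj_walk_iff_path_edges)
      ultimately show ?thesis using cross by blast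
    qed
    then show ?thesis unfolding I_def by blast
  qed
  define R where "R = (\<lambda>x. path_image (\<gamma> {x, v}))"
  have spoke: "connected (R x)" "f v \<in> R x" "f x \<in> R x" if "x \<in> V - {v}" for x
  proof -
    have e: "{x, v} \<in> E" using dom that by blast
    then show "connected (R x)" using edges unfolding R_def by (auto simp: connected_arc_image)
    have "f ` {x, v} \<subseteq> R x" using edges[OF e] unfolding R_def by blast
    then show "f v \<in> R x" "f x \<in> R x" by auto
  qed
  have touch: "R x \<inter> I xs \<subseteq> {f x}" if "adj_walk ?F (a # xs @ [b])" "x \<in> V - {v}" for x xs
  proof -
    have "R x \<inter> path_image (\<gamma> e) \<subseteq> {f x}" if e: "e \<in> path_edges (a # xs @ [b])" for e
    proof -
      have "e \<in> E" "v \<notin> e" using e \<open>adj_walk ?F (a # xs @ [b])\<close> by (auto simp: adj_walk_iff_path_edges)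
      then show ?thesis using cross[of "{x, v}" e] dom[OF \<open>x \<in> V - {v}\<close>] unfolding R_def by auto
    qed
    then show ?thesis unfolding I_def by blast
  qed
  have foot: "f x \<in> I xs - {f a, f b}"
    if "adj_walk ?F (a # xs @ [b])" "x \<in> set xs" "distinct (a # xs @ [b])" for x xs
  proof -
    have "\<exists>e\<in>path_edges (a # xs @ [b]). x \<in> e"
      using that path_edges_cover[of x "a # xs @ [b]"] by auto
    then obtain e where e: "e \<in> path_edges (a # xs @ [b])" "x \<in> e" by blast
    then have "e \<in> E" using that by (auto simp: adj_walk_iff_path_edges)
    then have "f x \<in> path_image (\<gamma> e)" using edges e by blast
    moreover have "f x \<noteq> f a" "f x \<noteq> f b"
      using sub[OF that(1)] inj that(2,3) unfolding inj_on_def by auto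
    ultimately show ?thesis unfolding I_def using e by auto
  qed
  \<comment> \<open>Any inner vertices can be the feet; the first ones are taken.\<close>
  define x1 x2 x3 where "x1 = hd p" and "x2 = hd q" and "x3 = hd r"
  have x: "x1 \<in> set p" "x2 \<in> set q" "x3 \<in> set r" using ne by (auto simp: x1_def x2_def x3_def)
  have xV: "x1 \<in> V - {v}" "x2 \<in> V - {v}" "x3 \<in> V - {v}"
    using x sub[OF walks(1)] sub[OF walks(2)] sub[OF walks(3)] by auto
  have pd: "distinct (a # p @ [b])" "distinct (a # q @ [b])" "distinct (a # r @ [b])"
    "set p \<inter> set q = {}" "set p \<inter> set r = {}" "set q \<inter> set r = {}"
    using dist by auto
  obtain g1 g2 g3 where g:
    "arc g1" "pathstart g1 = f a" "pathfinish g1 = f b" "path_image g1 = I p"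
    "arc g2" "pathstart g2 = f a" "pathfinish g2 = f b" "path_image g2 = I q"
    "arc g3" "pathstart g3 = f a" "pathfinish g3 = f b" "path_image g3 = I r"
    using arc[OF walks(1) pd(1)] arc[OF walks(2) pd(2)] arc[OF walks(3) pd(3)] by blast
  show False
  proof (rule no_planar_K33[OF g(1,5,9) g(2,6,10) g(3,7,11)])
    show "path_image g1 \<inter> path_image g2 \<subseteq> {f a, f b}"
      "path_image g1 \<inter> path_image g3 \<subseteq> {f a, f b}" "path_image g2 \<inter> path_image g3 \<subseteq> {f a, f b}"
      unfolding g using meet[OF walks(1,2) pd(4,1) ne(1)] meet[OF walks(1,3) pd(5,1) ne(1)]
        meet[OF walks(2,3) pd(6,2) ne(2)] by blast+
    show "connected (R x1)" "connected (R x2)" "connected (R x3)"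
      "f v \<in> R x1" "f v \<in> R x2" "f v \<in> R x3" "f x1 \<in> R x1" "f x2 \<in> R x2" "f x3 \<in> R x3"
      using spoke xV by auto
    show "f x1 \<in> path_image g1 - {f a, f b}" "f x2 \<in> path_image g2 - {f a, f b}"
      "f x3 \<in> path_image g3 - {f a, f b}"
      unfolding g using foot[OF walks(1) x(1) pd(1)] foot[OF walks(2) x(2) pd(2)]
        foot[OF walks(3) x(3) pd(3)] by blast+
    show "R x1 \<inter> (path_image g1 \<union> path_image g2 \<union> path_image g3) \<subseteq> {f x1}"
      "R x2 \<inter> (path_image g1 \<union> path_image g2 \<union> path_image g3) \<subseteq> {f x2}"
      "R x3 \<inter> (path_image g1 \<union> path_image g2 \<union> path_image g3) \<subseteq> {f x3}"
      unfolding g using walks[THEN touch[OF _ xV(1)]] walks[THEN touch[OF _ xV(2)]]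
        walks[THEN touch[OF _ xV(3)]] by blast+
  qed
qed

section \<open>Triangle-free graphs without thetas\<close>

lemma simple_graphE:
  assumes "simple_graph V E" "e \<in> E"
  obtains x y where "e = {x, y}" "x \<noteq> y" "x \<in> V" "y \<in> V"
proof -
  have "card e = 2" "e \<subseteq> V" using assms unfolding simple_graph_def by auto
  then show thesis using that unfolding card_2_iff by auto
qed

lemma simple_graph_finite: "simple_graph V E \<Longrightarrow> finite V \<and> finite E"
  unfolding simple_graph_def using finite_subset[of E "Pow V"] by auto

lemma simple_graph_induced: "simple_graph V E \<Longrightarrow> U \<subseteq> V \<Longrightarrow> simple_graph U (induced_edges E U)"
  unfolding simple_graph_def induced_edges_def by (auto intro: finite_subset)

lemma adj_walk_mono: "adj_walk E xs \<Longrightarrow> E \<subseteq> F \<Longrightarrow> adj_walk F xs"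
  by (auto simp: adj_walk_iff_path_edges)

lemma theta_free_mono: "theta_free F \<Longrightarrow> E \<subseteq> F \<Longrightarrow> theta_free E"
  unfolding theta_free_def by (meson adj_walk_mono)

definition triangle_free :: "'a set set \<Rightarrow> bool" where
  "triangle_free E \<longleftrightarrow> \<not> (\<exists>x y z. x \<noteq> y \<and> y \<noteq> z \<and> x \<noteq> z \<and> {x, y} \<in> E \<and> {y, z} \<in> E \<and> {x, z} \<in> E)"

lemma triangle_free_mono: "triangle_free F \<Longrightarrow> E \<subseteq> F \<Longrightarrow> triangle_free E"
  unfolding triangle_free_def by blast

section \<open>Reachability, paths and cycles as lists\<close>

lemma reach_refl [simp]: "reach W F x x"
  by (simp add: reach_def)

lemma reach_trans: "reach W F x y \<Longrightarrow> reach W F y z \<Longrightarrow> reach W F x z"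
  unfolding reach_def by (rule rtranclp_trans)

lemma reach_step: "reach W F x y \<Longrightarrow> y \<in> W \<Longrightarrow> z \<in> W \<Longrightarrow> {y, z} \<in> F \<Longrightarrow> reach W F x z"
  unfolding reach_def by (rule rtranclp.rtrancl_into_rtrancl) auto

lemma reach_edge: "x \<in> W \<Longrightarrow> y \<in> W \<Longrightarrow> {x, y} \<in> F \<Longrightarrow> reach W F x y"
  using reach_step[of W F x x y] by simp

lemma reach_sym: "reach W F x y \<Longrightarrow> reach W F y x"
  unfolding reach_def
proof (induction rule: rtranclp_induct)
  case (step y z)
  then show ?case by (intro converse_rtranclp_into_rtranclp[of _ z y]) (auto simp: insert_commute)
qed simp

lemma reach_exit:
  assumes "reach W F x y" "x \<in> S" "y \<notin> S"
  shows "\<exists>a b. a \<in> S \<and> a \<in> W \<and> b \<in> W \<and> b \<notin> S \<and> {a, b} \<in> F"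
  using assms unfolding reach_def by (induction rule: rtranclp_induct) auto

text \<open>The path grows with the walk; when the next vertex already occurs, the path is cut back
  to that occurrence.\<close>

lemma reach_path:
  assumes "reach W F x y" "x \<in> W"
  shows "\<exists>xs. adj_walk F xs \<and> distinct xs \<and> xs \<noteq> [] \<and> hd xs = x \<and> last xs = y \<and> set xs \<subseteq> W"
  using assms unfolding reach_def
proof (induction rule: rtranclp_induct)
  case base
  then show ?case by (intro exI[of _ "[x]"]) auto
next
  case (step y z)
  then obtain xs where xs: "adj_walk F xs" "distinct xs" "xs \<noteq> []" "hd xs = x" "last xs = y" "set xs \<subseteq> W"
    by auto
  show ?case
  proof (cases "z \<in> set xs")
    case True
    then obtain ys zs where "xs = ys @ z # zs" by (meson split_list)
    then show ?thesis using xs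
      by (intro exI[of _ "ys @ [z]"]) (auto simp: adj_walk_append hd_append split: if_splits)
  next
    case False
    then show ?thesis using xs step.hyps
      by (intro exI[of _ "xs @ [z]"]) (auto simp: adj_walk_append)
  qed
qed

lemma path_edges_append:
  "path_edges (xs @ ys) = path_edges xs \<union> path_edges ys \<union>
     (if xs = [] \<or> ys = [] then {} else {{last xs, hd ys}})"
proof (induction xs rule: path_edges.induct)
  case ("2_2" x) then show ?case by (cases ys) auto
qed auto

lemma path_edges_nth: "path_edges xs = {{xs ! i, xs ! Suc i} | i. Suc i < length xs}"
proof (induction xs rule: path_edges.induct)
  case (1 x y xs)
  have "{{(x # y # xs) ! i, (x # y # xs) ! Suc i} | i. Suc i < length (x # y # xs)} =
    insert {x, y} {{(y # xs) ! i, (y # xs) ! Suc i} | i. Suc i < length (y # xs)}" (is "?L = ?R")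
  proof
    show "?L \<subseteq> ?R"
    proof
      fix e assume "e \<in> ?L"
      then obtain i where i: "e = {(x # y # xs) ! i, (x # y # xs) ! Suc i}" "Suc i < length (x # y # xs)" by blast
      then show "e \<in> ?R" by (cases i) auto
    qed
    show "?R \<subseteq> ?L"
    proof
      fix e assume "e \<in> ?R"
      then consider "e = {x, y}" | i where "e = {(y # xs) ! i, (y # xs) ! Suc i}" "Suc i < length (y # xs)" by blast
      then show "e \<in> ?L"
      proof cases
        case 1 then show ?thesis by (intro CollectI exI[of _ 0]) auto
      next
        case (2 i) then show ?thesis by (intro CollectI exI[of _ "Suc i"]) auto
      qed
    qed
  qed
  then show ?case using 1 by simp
qed auto

text \<open>Trades index arithmetic modulo the length for a path and its closing edge, so that
  cycles can be treated by list operations.\<close>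

lemma cycle_edges_eq:
  assumes "c \<noteq> []"
  shows "cycle_edges c = insert {last c, hd c} (path_edges c)"
proof -
  let ?n = "length c"
  \<comment> \<open>The last index is the only one whose successor wraps round to 0.\<close>
  have "{..<?n} = insert (?n - 1) {i. Suc i < ?n}" using assms by (auto simp: Suc_lessI)
  then have "cycle_edges c = (\<lambda>i. {c ! i, c ! ((i + 1) mod ?n)}) ` insert (?n - 1) {i. Suc i < ?n}"
    unfolding cycle_edges_def by (simp only: flip: \<open>{..<?n} = _\<close>) auto
  also have "\<dots> = insert {c ! (?n - 1), c ! 0} ((\<lambda>i. {c ! i, c ! Suc i}) ` {i. Suc i < ?n})"
    using assms by (auto simp: Suc_diff_1)
  also have "\<dots> = insert {last c, hd c} (path_edges c)"
    using assms by (auto simp: path_edges_nth last_conv_nth hd_conv_nth)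
  finally show ?thesis .
qed

lemma cycle_edges_Cons: "cycle_edges (x # xs) = insert {last (x # xs), x} (path_edges (x # xs))"
  using cycle_edges_eq[of "x # xs"] by simp

lemma cycle_edges_rotate: "cycle_edges (xs @ ys) = cycle_edges (ys @ xs)"
proof (cases "xs = [] \<or> ys = []")
  case False
  then show ?thesis by (simp add: cycle_edges_eq path_edges_append insert_commute Un_commute)
qed auto

lemma finite_cycle_edges [simp]: "finite (cycle_edges c)"
  by (simp add: cycle_edges_def)

lemma cycle_edges_vertices: "e \<in> cycle_edges c \<Longrightarrow> e \<subseteq> set c"
  unfolding cycle_edges_def by (cases "c = []") (auto intro!: nth_mem)

lemma cycle_edges_cover: "x \<in> set c \<Longrightarrow> \<exists>e\<in>cycle_edges c. x \<in> e"
proof -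
  assume "x \<in> set c"
  then obtain i where "i < length c" "x = c ! i" by (metis in_set_conv_nth)
  then show ?thesis unfolding cycle_edges_def
    by (intro bexI[of _ "{c ! i, c ! ((i + 1) mod length c)}"]) auto
qed

lemma card_cycle_edges_le: "card (cycle_edges c) \<le> length c"
proof -
  have "cycle_edges c = (\<lambda>i. {c ! i, c ! ((i + 1) mod length c)}) ` {..<length c}"
    unfolding cycle_edges_def by auto
  then show ?thesis
    using card_image_le[of "{..<length c}" "\<lambda>i. {c ! i, c ! ((i + 1) mod length c)}"] by simp
qed

text \<open>\<open>is_cycle\<close> in terms of the edge set alone, convenient when passing to
  subgraphs; \<open>graph_cycle_vertices\<close> recovers the vertex condition.\<close>

definition graph_cycle :: "'a set set \<Rightarrow> 'a list \<Rightarrow> bool" where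
  "graph_cycle E c \<longleftrightarrow> 3 \<le> length c \<and> distinct c \<and> cycle_edges c \<subseteq> E"

lemma graph_cycle_Cons:
  "graph_cycle E (x # xs) \<longleftrightarrow>
     2 \<le> length xs \<and> distinct (x # xs) \<and> adj_walk E (x # xs) \<and> {last xs, x} \<in> E"
proof (cases "xs = []")
  case False
  then show ?thesis
    by (auto simp: graph_cycle_def cycle_edges_Cons adj_walk_iff_path_edges simp del: path_edges.simps)
qed (simp add: graph_cycle_def)

lemma graph_cycle_vertices:
  assumes "simple_graph V E" "graph_cycle E c"
  shows "set c \<subseteq> V"
proof
  fix x assume "x \<in> set c"
  then obtain e where "e \<in> cycle_edges c" "x \<in> e" using cycle_edges_cover by metis
  then show "x \<in> V" using assms unfolding graph_cycle_def simple_graph_def by blast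
qed

lemma graph_cycle_start_at:
  assumes "graph_cycle E c" "x \<in> set c"
  obtains xs where "graph_cycle E (x # xs)" "set (x # xs) = set c" "length (x # xs) = length c"
    "cycle_edges (x # xs) = cycle_edges c"
proof -
  obtain p q where c: "c = p @ x # q" using assms by (meson split_list)
  then show thesis using assms cycle_edges_rotate[of p "x # q"]
    by (intro that[of "q @ p"]) (auto simp: graph_cycle_def)
qed

text \<open>A cycle with two crossing chords is a subdivided complete graph on \<open>x\<close>,
  \<open>s\<close>, \<open>y\<close>, \<open>t\<close>. A further vertex between \<open>x\<close>
  and \<open>s\<close> or between \<open>s\<close> and \<open>y\<close> would give a theta between
  these two branch vertices. Otherwise \<open>s\<close> is adjacent to both \<open>x\<close> and
  \<open>y\<close>, and the chord closes a triangle.\<close>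

lemma chord_noncrossing:
  assumes "theta_free E" "triangle_free E" "graph_cycle E (x # xs @ y # ys)" "{x, y} \<in> E"
    "s \<in> set xs" "t \<in> set ys"
  shows "{s, t} \<notin> E"
proof
  assume st: "{s, t} \<in> E"
  obtain s1 s2 t1 t2 where l: "xs = s1 @ s # s2" "ys = t1 @ t # t2" using assms by (meson split_list)
  have cyc: "distinct (x # xs @ y # ys)" "adj_walk E (x # xs @ y # ys)" "{last (y # ys), x} \<in> E"
    using assms(3) unfolding graph_cycle_Cons by auto
  note simps = l adj_walk_Cons adj_walk_append insert_commute hd_append last_rev hd_rev
  have no: "\<And>a b p q r. p \<noteq> [] \<Longrightarrow> q \<noteq> [] \<Longrightarrow> r \<noteq> [] \<Longrightarrow> distinct (a # b # p @ q @ r) \<Longrightarrow>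
     adj_walk E (a # p @ [b]) \<Longrightarrow> adj_walk E (a # q @ [b]) \<Longrightarrow> adj_walk E (a # r @ [b]) \<Longrightarrow> False"
    using assms(1) unfolding theta_free_def by blast
  \<comment> \<open>Three paths from \<open>x\<close> to \<open>s\<close>: along \<open>s1\<close>;
    over the chord to \<open>y\<close> and back along \<open>s2\<close>; backwards round the cycle
    to \<open>t\<close> and over the edge \<open>{s, t}\<close>. The other two cases are
    symmetric.\<close>
  have "s1 = []"
  proof (rule ccontr)
    assume "s1 \<noteq> []"
    then show False using cyc st assms(4)
      by (intro no[of s1 "y # rev s2" "rev t2 @ [t]" x s])
         (auto simp: simps split: if_splits)
  qed
  moreover have "s2 = []"
  proof (rule ccontr)
    assume "s2 \<noteq> []"
    then show False using cyc st assms(4)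
      by (intro no[of s2 "rev s1 @ [x]" "t # rev t1" s y])
         (auto simp: simps split: if_splits)
  qed
  moreover have "t1 = []"
  proof (rule ccontr)
    assume "t1 \<noteq> []"
    then show False using cyc st assms(4)
      by (intro no[of t1 "x # rev t2" "rev s2 @ [s]" y t])
         (auto simp: simps split: if_splits)
  qed
  ultimately have "{x, s} \<in> E" "{s, y} \<in> E" "x \<noteq> s" "s \<noteq> y" "x \<noteq> y"
    using cyc by (auto simp: simps)
  then show False using assms(2,4) unfolding triangle_free_def by blast
qed

text \<open>If \<open>x\<close> and \<open>y\<close> are neighbours on the cycle, the ear can
  replace the edge between them and gives a longer cycle. If not, both parts of the cycle have inner
  vertices and form a theta with the ear.\<close>

lemma longest_cycle_ear:
  assumes "theta_free E" "graph_cycle E c" "\<And>c'. graph_cycle E c' \<Longrightarrow> length c' \<le> length c"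
    and "x \<in> set c" "y \<in> set c" "x \<noteq> y"
    and "ear \<noteq> []" "distinct ear" "adj_walk E ear" "set ear \<inter> set c = {}"
    and "{x, hd ear} \<in> E" "{last ear, y} \<in> E"
  shows False
proof -
  obtain ys where ys: "graph_cycle E (x # ys)" "set (x # ys) = set c" "length (x # ys) = length c"
    using graph_cycle_start_at assms(2,4) by metis
  then have "y \<in> set ys" using assms(5,6) by (metis set_ConsD)
  then obtain p q where l: "ys = p @ y # q" by (meson split_list)
  have cyc: "distinct (x # p @ y # q)" "adj_walk E (x # p @ y # q)" "{last (y # q), x} \<in> E"
    using ys(1) unfolding graph_cycle_Cons l by auto
  have disj: "set ear \<inter> set (x # p @ y # q) = {}" using ys assms l by auto
  note simps = adj_walk_Cons adj_walk_append insert_commute hd_append last_rev hd_rev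
  have "p \<noteq> []"
  proof
    assume "p = []"
    then have "graph_cycle E (x # ear @ y # q)"
      using cyc disj assms(6-) unfolding graph_cycle_Cons by (auto simp: simps Suc_le_eq split: if_splits)
    then show False using assms(3)[of "x # ear @ y # q"] ys(3) l \<open>p = []\<close> \<open>ear \<noteq> []\<close> by (cases ear) auto
  qed
  moreover have "q \<noteq> []"
  proof
    assume "q = []"
    then have "graph_cycle E (x # p @ y # rev ear)"
      using cyc disj assms(6-) unfolding graph_cycle_Cons by (auto simp: simps Suc_le_eq split: if_splits)
    then show False using assms(3)[of "x # p @ y # rev ear"] ys(3) l \<open>q = []\<close> \<open>ear \<noteq> []\<close> by (cases ear) auto
  qed
  ultimately have "p \<noteq> [] \<and> rev q \<noteq> [] \<and> ear \<noteq> [] \<and> distinct (x # y # p @ rev q @ ear) \<and>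
    adj_walk E (x # p @ [y]) \<and> adj_walk E (x # rev q @ [y]) \<and> adj_walk E (x # ear @ [y])"
    using cyc disj assms(7-) by (auto simp: simps split: if_splits)
  then show False using assms(1) unfolding theta_free_def by blast
qed

text \<open>Strong induction: the graph is cut along a bridge, at a vertex of a longest cycle, or
  along a chord of a spanning cycle. The weaker bound covers single vertices, where the stronger one
  fails. Below, \<open>m\<close> is the number of vertices.\<close>

lemma card_triangle_theta_free:
  assumes "simple_graph V E" "theta_free E" "triangle_free E" "V \<noteq> {}"
  shows "2 * card E + 3 \<le> 3 * card V \<and> (2 \<le> card V \<longrightarrow> 2 * card E + 4 \<le> 3 * card V)"
  using assms
proof (induction "card V" arbitrary: V E rule: less_induct)
  case (less V E)
  note G = less.prems
  have fin: "finite V" "finite E" using simple_graph_finite[OF G(1)] by auto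
  have IH: "2 * card (induced_edges E U) + 3 \<le> 3 * card U \<and>
      (2 \<le> card U \<longrightarrow> 2 * card (induced_edges E U) + 4 \<le> 3 * card U)"
    if "U \<subset> V" "U \<noteq> {}" for U
  proof (rule less.hyps)
    show "card U < card V" using fin that psubset_card_mono by blast
    show "simple_graph U (induced_edges E U)" using simple_graph_induced G that by blast
    have "induced_edges E U \<subseteq> E" by (auto simp: induced_edges_def)
    then show "theta_free (induced_edges E U)" "triangle_free (induced_edges E U)"
      using G theta_free_mono triangle_free_mono by blast+
  qed (fact that)
  have finI: "finite (induced_edges E U)" for U using fin by (simp add: induced_edges_def)
  show ?case
  proof (cases "\<exists>c. graph_cycle E c")
    case False
    show ?thesis
    proof (cases "E = {}")
      case True
      then show ?thesis using fin G(4) by (cases "card V") auto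
    next
      case False
      then obtain x y where xy: "{x, y} \<in> E" "x \<noteq> y" "x \<in> V" "y \<in> V"
        using simple_graphE[OF G(1)] by (metis ex_in_conv)
      \<comment> \<open>The side of \<open>x\<close> after deletion of the edge
        \<open>{x, y}\<close>. In the absence of cycles the edge is a bridge, so \<open>y\<close> is
        on the other side.\<close>
      define D where "D = {u\<in>V. reach V (E - {{x, y}}) x u}"
      have "y \<notin> D"
      proof
        assume "y \<in> D"
        then obtain xs where xs: "adj_walk (E - {{x, y}}) xs" "distinct xs" "xs \<noteq> []" "hd xs = x" "last xs = y"
          using reach_path xy(3) unfolding D_def by (metis (no_types, lifting) mem_Collect_eq)
        obtain ys where ys: "xs = x # ys" using xs by (cases xs) auto
        then obtain z zs where zs: "ys = z # zs" using xs xy by (cases ys) auto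
        have "zs \<noteq> []" using xs ys zs by auto
        then have "graph_cycle E xs"
          using xs ys zs xy adj_walk_mono[OF xs(1), of E]
          unfolding ys graph_cycle_Cons by (auto simp: insert_commute Suc_le_eq)
        then show False using \<open>\<nexists>c. graph_cycle E c\<close> by blast
      qed
      have "x \<in> D" "D \<subseteq> V" using xy by (auto simp: D_def)
      then have D: "x \<in> D" "D \<subseteq> V" "D \<subset> V" "V - D \<subset> V" "V - D \<noteq> {}" "D \<noteq> {}"
        using xy \<open>y \<notin> D\<close> by blast+
      have "E \<subseteq> induced_edges E D \<union> induced_edges E (V - D) \<union> {{x, y}}"
      proof
        fix e assume "e \<in> E"
        then obtain s t where st: "e = {s, t}" "s \<in> V" "t \<in> V" using simple_graphE[OF G(1)] by metis
        have closed: "t' \<in> D" if "{s', t'} \<in> E" "{s', t'} \<noteq> {x, y}" "s' \<in> D" "t' \<in> V" for s' t'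
          using that reach_step[of V "E - {{x, y}}" x s' t'] by (auto simp: D_def)
        show "e \<in> induced_edges E D \<union> induced_edges E (V - D) \<union> {{x, y}}"
        proof (cases "e = {x, y}")
          case False
          then have "s \<in> D \<longleftrightarrow> t \<in> D"
            using closed[of s t] closed[of t s] st \<open>e \<in> E\<close> by (auto simp: insert_commute)
          then show ?thesis using st \<open>e \<in> E\<close> by (auto simp: induced_edges_def)
        qed auto
      qed
      then have "card E \<le> card (induced_edges E D \<union> induced_edges E (V - D) \<union> {{x, y}})"
        using finI by (intro card_mono) auto
      also have "\<dots> \<le> card (induced_edges E D) + card (induced_edges E (V - D)) + 1"
        by (intro order_trans[OF card_Un_le] add_mono) (auto simp: card_Un_le)
      finally have "card E \<le> card (induced_edges E D) + card (induced_edges E (V - D)) + 1" .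
      moreover have "card D + card (V - D) = card V"
        using D fin by (metis card_Diff_subset card_mono finite_subset le_add_diff_inverse)
      \<comment> \<open>For parts with \<open>a + b = m\<close> vertices, twice the number of edges
        is at most \<open>2 + (3 a - 3) + (3 b - 3) = 3 m - 4\<close>.\<close>
      ultimately show ?thesis using IH[of D] IH[of "V - D"] D by auto
    qed
  next
    case True
    define P where "P = graph_cycle E"
    have len: "graph_cycle E c \<Longrightarrow> length c \<le> card V" for c
      using graph_cycle_vertices[OF G(1)] fin unfolding graph_cycle_def by (metis card_mono distinct_card)
    then have "\<forall>c. P c \<longrightarrow> length c < Suc (card V)" by (auto simp: P_def le_imp_less_Suc)
    then obtain c where c: "graph_cycle E c" and max: "\<And>c'. graph_cycle E c' \<Longrightarrow> length c' \<le> length c"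
      using True ex_has_greatest_nat[of P _ length "Suc (card V)"] unfolding P_def by metis
    have cV: "set c \<subseteq> V" using graph_cycle_vertices G(1) c by metis
    have cc: "card (set c) = length c" "3 \<le> length c" using c by (auto simp: graph_cycle_def distinct_card)
    show ?thesis
    proof (cases "set c = V")
      case False
      then obtain z where z: "z \<in> V - set c" using cV by blast
      \<comment> \<open>A component of the graph off the longest cycle. Two attachments to different
        cycle vertices would produce an ear.\<close>
      define D where "D = {d\<in>V - set c. reach (V - set c) E z d}"
      have zD: "z \<in> D" using z by (auto simp: D_def)
      have attach: "x = y" if "x \<in> set c" "y \<in> set c" "d \<in> D" "d' \<in> D" "{x, d} \<in> E" "{y, d'} \<in> E" for x y d d'
      proof (rule ccontr)
        assume "x \<noteq> y"
        have "reach (V - set c) E d d'" using that reach_sym reach_trans unfolding D_def by fast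
        moreover have "d \<in> V - set c" using that(3) unfolding D_def by blast
        ultimately obtain ear where "adj_walk E ear" "distinct ear" "ear \<noteq> []" "hd ear = d" "last ear = d'"
          "set ear \<subseteq> V - set c"
          using reach_path by metis
        then show False
          using longest_cycle_ear[OF G(2) c max that(1,2) \<open>x \<noteq> y\<close>, of ear] that by (auto simp: insert_commute)
      qed
      \<comment> \<open>If \<open>D\<close> has no neighbour on the cycle, any cycle vertex will do
        as the cut point, here \<open>hd c\<close>.\<close>
      obtain x where x: "x \<in> set c" "\<And>y d. y \<in> set c \<Longrightarrow> d \<in> D \<Longrightarrow> {y, d} \<in> E \<Longrightarrow> y = x"
      proof (cases "\<exists>y d. y \<in> set c \<and> d \<in> D \<and> {y, d} \<in> E")
        case True
        then show thesis using attach that by metis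
      next
        case False
        then show thesis using that[of "hd c"] cc by (cases c) auto
      qed
      have DV: "D \<subseteq> V - set c" by (auto simp: D_def)
      have sub: "E \<subseteq> induced_edges E (insert x D) \<union> induced_edges E (V - D)"
      proof
        fix e assume "e \<in> E"
        then obtain s t where st: "e = {s, t}" "s \<in> V" "t \<in> V" using simple_graphE[OF G(1)] by metis
        have closed: "t' \<in> insert x D" if "{s', t'} \<in> E" "s' \<in> D" "t' \<in> V" for s' t'
        proof (cases "t' \<in> set c")
          case True then show ?thesis using x that by (auto simp: insert_commute)
        next
          case False
          then show ?thesis using that reach_step[of "V - set c" E z s' t'] by (auto simp: D_def)
        qed
        then show "e \<in> induced_edges E (insert x D) \<union> induced_edges E (V - D)"
          using closed[of s t] closed[of t s] st \<open>e \<in> E\<close> unfolding induced_edges_def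
          by (cases "s \<in> D"; cases "t \<in> D") (auto simp: insert_commute)
      qed
      have "card E \<le> card (induced_edges E (insert x D) \<union> induced_edges E (V - D))"
        using sub finI by (intro card_mono) auto
      also have "\<dots> \<le> card (induced_edges E (insert x D)) + card (induced_edges E (V - D))"
        by (rule card_Un_le)
      finally have cE: "card E \<le> card (induced_edges E (insert x D)) + card (induced_edges E (V - D))" .
      have finD: "finite D" using DV fin finite_subset by blast
      have "x \<notin> D" using x DV by blast
      then have c1: "card (insert x D) = Suc (card D)" using finD by auto
      have c2: "card (V - D) = card V - card D" "card D \<le> card V"
        using DV fin finD by (auto intro!: card_Diff_subset card_mono)
      have "card (set c) \<le> card (V - D)" using DV cV fin by (intro card_mono) auto
      then have c3: "3 \<le> card (V - D)" using cc by auto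
      have c4: "1 \<le> card D" using zD finD by (metis One_nat_def Suc_leI card_gt_0_iff empty_iff)
      have "insert x D \<noteq> V"
        using c1 c2 c3 by auto
      then have "insert x D \<subset> V" using x cV DV by blast
      moreover have "V - D \<subset> V" using zD DV by blast
      moreover have "V - D \<noteq> {}" using c3 by (metis card.empty not_numeral_le_zero)
      \<comment> \<open>Both pieces have at least two vertices and overlap in \<open>x\<close>
        alone. With \<open>d = card D\<close>, twice the number of edges is at most
        \<open>(3 (d + 1) - 4) + (3 (m - d) - 4) = 3 m - 5\<close>.\<close>
      ultimately show ?thesis
        using IH[of "insert x D"] IH[of "V - D"] cE c1 c2 c3 c4 by auto
    next
      case True
      then have n: "card V = length c" using cc by auto
      show ?thesis
      proof (cases "E \<subseteq> cycle_edges c")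
        case True
        then have "card E \<le> length c" using card_mono card_cycle_edges_le finite_cycle_edges by (metis le_trans)
        \<comment> \<open>At most \<open>m\<close> edges suffice once
          \<open>2 m + 4 \<le> 3 m\<close>, that is, once the cycle is longer than a
          triangle.\<close>
        moreover have "length c \<noteq> 3"
        proof
          assume "length c = 3"
          then obtain u v w where "c = [u, v, w]" by (auto simp: numeral_3_eq_3 length_Suc_conv)
          then have "u \<noteq> v \<and> v \<noteq> w \<and> u \<noteq> w \<and> {u, v} \<in> E \<and> {v, w} \<in> E \<and> {u, w} \<in> E"
            using c by (auto simp: graph_cycle_Cons insert_commute)
          then show False using G(3) unfolding triangle_free_def by blast
        qed
        ultimately show ?thesis using n cc by auto
      next
        case False
        then obtain x y where xy: "{x, y} \<in> E" "{x, y} \<notin> cycle_edges c" "x \<noteq> y" "x \<in> V" "y \<in> V"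
          using simple_graphE[OF G(1)] by (metis subsetI)
        obtain zs where zs: "graph_cycle E (x # zs)" "set (x # zs) = set c" "cycle_edges (x # zs) = cycle_edges c"
          using graph_cycle_start_at[OF c] xy \<open>set c = V\<close> by metis
        then obtain xs ys where l: "zs = xs @ y # ys" using xy \<open>set c = V\<close> by (metis set_ConsD split_list)
        have cyc: "graph_cycle E (x # xs @ y # ys)" using zs l by auto
        have ne: "xs \<noteq> []" "ys \<noteq> []"
        proof -
          show "xs \<noteq> []" using xy(2) unfolding zs(3)[symmetric] l by (auto simp: cycle_edges_Cons)
          show "ys \<noteq> []" using xy(2) unfolding zs(3)[symmetric] l by (auto simp: cycle_edges_Cons insert_commute)
        qed
        have dist: "distinct (x # xs @ y # ys)" using cyc by (simp add: graph_cycle_def)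
        have V: "V = set (x # xs @ y # ys)" using zs l \<open>set c = V\<close> by auto
        \<comment> \<open>The two halves into which the chord cuts the spanning cycle; both keep its
          ends. No edge leads from one open half to the other, as chords do not cross.\<close>
        define V1 V2 where "V1 = insert x (insert y (set xs))" and "V2 = insert x (insert y (set ys))"
        have sub: "E \<subseteq> induced_edges E V1 \<union> induced_edges E V2"
        proof
          fix e assume "e \<in> E"
          then obtain s t where st: "e = {s, t}" "s \<in> V" "t \<in> V" using simple_graphE[OF G(1)] by metis
          then have "\<not> (s \<in> set xs \<and> t \<in> set ys)" "\<not> (t \<in> set xs \<and> s \<in> set ys)"
            using chord_noncrossing[OF G(2,3) cyc xy(1), of s t] \<open>e \<in> E\<close>
              chord_noncrossing[OF G(2,3) cyc xy(1), of t s] by (auto simp: insert_commute)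
          then show "e \<in> induced_edges E V1 \<union> induced_edges E V2"
            using st \<open>e \<in> E\<close> unfolding induced_edges_def V1_def V2_def V by auto
        qed
        have "{x, y} \<in> induced_edges E V1 \<inter> induced_edges E V2"
          using xy by (auto simp: induced_edges_def V1_def V2_def)
        then have "1 \<le> card (induced_edges E V1 \<inter> induced_edges E V2)"
          using finI by (metis One_nat_def Suc_leI card_gt_0_iff empty_iff finite_Int)
        moreover have "card E \<le> card (induced_edges E V1 \<union> induced_edges E V2)"
          using sub finI by (intro card_mono) auto
        ultimately have cE: "card E + 1 \<le> card (induced_edges E V1) + card (induced_edges E V2)"
          using card_Un_Int[OF finI finI, of V1 V2] by linarith
        have c12: "card V1 = length xs + 2" "card V2 = length ys + 2" "card V = length xs + length ys + 2"
          unfolding V1_def V2_def V using dist by (auto simp: distinct_card card_Un_disjoint)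
        have "V1 \<subset> V" "V2 \<subset> V" using ne dist unfolding V1_def V2_def V by (auto simp: neq_Nil_conv)
        moreover have "V1 \<noteq> {}" "V2 \<noteq> {}" by (auto simp: V1_def V2_def)
        \<comment> \<open>The chord is counted in both halves, and so are \<open>x\<close> and
          \<open>y\<close>: \<open>2 (card E + 1) \<le> 3 (m + 2) - 8\<close>.\<close>
        ultimately show ?thesis using IH[of V1] IH[of V2] c12 cE by auto
      qed
    qed
  qed
qed

section \<open>Edge-disjoint cycles through a dominating vertex\<close>

definition cycle_set :: "'a set set \<Rightarrow> bool" where
  "cycle_set X \<longleftrightarrow> (\<exists>c. 3 \<le> length c \<and> distinct c \<and> cycle_edges c = X)"

text \<open>Cycles are represented by their edge sets, so that a packing is a plain disjoint family
  without indices. Disjoint members are automatically distinct, as a cycle has at least one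
  edge.\<close>

definition packs :: "'a set set \<Rightarrow> nat \<Rightarrow> bool" where
  "packs E n \<longleftrightarrow> (\<exists>\<C>. finite \<C> \<and> card \<C> = n \<and> (\<forall>X\<in>\<C>. cycle_set X \<and> X \<subseteq> E) \<and>
     pairwise disjnt \<C>)"

lemma cycle_set_nonempty: "cycle_set X \<Longrightarrow> X \<noteq> {}"
proof -
  assume "cycle_set X"
  then obtain c where "3 \<le> length c" "cycle_edges c = X" unfolding cycle_set_def by blast
  then show ?thesis by (cases c) (auto simp: cycle_edges_Cons)
qed

lemma packs_0: "packs E 0"
  by (auto simp: packs_def intro: exI[of _ "{}"])

lemma packs_mono: "packs E n \<Longrightarrow> E \<subseteq> F \<Longrightarrow> packs F n"
  unfolding packs_def by blast

lemma packs_le: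
  assumes "packs E n" "m \<le> n"
  shows "packs E m"
proof -
  obtain \<C> where \<C>: "finite \<C>" "card \<C> = n" "\<forall>X\<in>\<C>. cycle_set X \<and> X \<subseteq> E" "pairwise disjnt \<C>"
    using assms unfolding packs_def by blast
  then obtain \<D> where "\<D> \<subseteq> \<C>" "card \<D> = m" "finite \<D>"
    using assms obtain_subset_with_card_n by metis
  then show ?thesis using \<C> unfolding packs_def by (intro exI[of _ \<D>]) (auto intro: pairwise_subset)
qed

lemma packs_Un:
  assumes "packs E m" "packs F n" "E \<inter> F = {}"
  shows "packs (E \<union> F) (m + n)"
proof -
  obtain \<C> where \<C>: "finite \<C>" "card \<C> = m" "\<forall>X\<in>\<C>. cycle_set X \<and> X \<subseteq> E" "pairwise disjnt \<C>"
    using assms unfolding packs_def by blast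
  obtain \<D> where \<D>: "finite \<D>" "card \<D> = n" "\<forall>X\<in>\<D>. cycle_set X \<and> X \<subseteq> F" "pairwise disjnt \<D>"
    using assms unfolding packs_def by blast
  have cross: "disjnt X Y" if "X \<in> \<C>" "Y \<in> \<D>" for X Y
    using that \<C> \<D> assms(3) unfolding disjnt_def by blast
  have "\<C> \<inter> \<D> = {}"
  proof (rule ccontr)
    assume "\<C> \<inter> \<D> \<noteq> {}"
    then obtain X where "X \<in> \<C>" "X \<in> \<D>" by blast
    then show False using cross[of X X] \<C>(3) cycle_set_nonempty unfolding disjnt_def by blast
  qed
  then have "card (\<C> \<union> \<D>) = m + n" using \<C> \<D> by (simp add: card_Un_disjoint)
  moreover have "pairwise disjnt (\<C> \<union> \<D>)"
    using \<C>(4) \<D>(4) cross unfolding pairwise_def disjnt_def by blast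
  ultimately show ?thesis
    unfolding packs_def using \<C> \<D> by (intro exI[of _ "\<C> \<union> \<D>"]) auto
qed

lemma packs_cycle: "cycle_set X \<Longrightarrow> packs X 1"
  unfolding packs_def by (intro exI[of _ "{X}"]) auto

lemma packs_UN:
  assumes "finite I" "\<And>i. i \<in> I \<Longrightarrow> cycle_set (X i)"
    and "\<And>i j. i \<in> I \<Longrightarrow> j \<in> I \<Longrightarrow> i \<noteq> j \<Longrightarrow> X i \<inter> X j = {}"
  shows "packs (\<Union>i\<in>I. X i) (card I)"
  using assms
proof (induction I rule: finite_induct)
  case (insert i I)
  have "packs (\<Union>i\<in>I. X i) (card I)" by (rule insert.IH) (use insert.prems in auto)
  moreover have "packs (X i) 1" using insert.prems(1) by (rule packs_cycle) simp
  moreover have "X i \<inter> X j = {}" if "j \<in> I" for j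
    using insert.prems(2)[of i j] insert.hyps(2) that by blast
  then have "X i \<inter> (\<Union>i\<in>I. X i) = {}" by blast
  ultimately have "packs (X i \<union> (\<Union>i\<in>I. X i)) (1 + card I)" by (intro packs_Un)
  then show ?case using insert by simp
qed (simp add: packs_0)

lemma cycle_set_3: "distinct [x, y, z] \<Longrightarrow> cycle_set {{x, y}, {y, z}, {x, z}}"
  unfolding cycle_set_def
  by (intro exI[of _ "[x, y, z]"]) (auto simp: cycle_edges_Cons insert_commute)

lemma cycle_set_4: "distinct [w, x, y, z] \<Longrightarrow> cycle_set {{w, x}, {x, y}, {y, z}, {w, z}}"
  unfolding cycle_set_def
  by (intro exI[of _ "[w, x, y, z]"]) (auto simp: cycle_edges_Cons insert_commute)

lemma has_k_edge_disjoint_cycles_if_packs: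
  assumes "simple_graph V E" "packs E k"
  shows "has_k_edge_disjoint_cycles V E k"
proof -
  obtain \<C> where \<C>: "finite \<C>" "card \<C> = k" "\<forall>X\<in>\<C>. cycle_set X \<and> X \<subseteq> E" "pairwise disjnt \<C>"
    using assms unfolding packs_def by blast
  obtain h where h: "bij_betw h {..<k} \<C>"
    using \<C> by (metis bij_betw_from_nat_into_finite)
  then have hC: "h i \<in> \<C>" if "i < k" for i using that bij_betwE by fastforce
  define C where "C = (\<lambda>i. SOME c. 3 \<le> length c \<and> distinct c \<and> cycle_edges c = h i)"
  have C: "3 \<le> length (C i) \<and> distinct (C i) \<and> cycle_edges (C i) = h i" if "i < k" for i
    using \<C> hC[OF that] unfolding C_def cycle_set_def by (metis (mono_tags, lifting) someI_ex)
  have "is_cycle V E (C i)" if "i < k" for i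
  proof -
    have "graph_cycle E (C i)" using C[OF that] \<C> hC[OF that] unfolding graph_cycle_def by auto
    then show ?thesis using graph_cycle_vertices[OF assms(1)] unfolding is_cycle_def graph_cycle_def by auto
  qed
  moreover have "cycle_edges (C i) \<inter> cycle_edges (C j) = {}" if "i < k" "j < k" "i \<noteq> j" for i j
  proof -
    have "h i \<noteq> h j" using h that unfolding bij_betw_def inj_on_def by blast
    then show ?thesis using C that hC \<C>(4) unfolding pairwise_def disjnt_def by metis
  qed
  ultimately show ?thesis unfolding has_k_edge_disjoint_cycles_def by blast
qed

text \<open>The construction order of a spanning tree: each new vertex \<open>u\<close> hangs on an
  older parent \<open>w\<close>, so undoing the steps removes leaves of the tree.\<close>

inductive grown :: "'a set set \<Rightarrow> 'a set \<Rightarrow> bool" for F where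
  single: "grown F {r}"
| step: "grown F S \<Longrightarrow> w \<in> S \<Longrightarrow> u \<notin> S \<Longrightarrow> {u, w} \<in> F \<Longrightarrow> grown F (insert u S)"

lemma grown_finite: "grown F S \<Longrightarrow> finite S"
  by (induction rule: grown.induct) auto

text \<open>A largest grown subset of \<open>W\<close> is all of \<open>W\<close>, for otherwise
  some edge leaves it and allows one more step.\<close>

lemma connected_graph_grown:
  assumes "connected_graph W F" "finite W"
  shows "grown F W"
proof -
  define P where "P = (\<lambda>S. grown F S \<and> S \<subseteq> W)"
  obtain r where r: "r \<in> W" using assms(1) unfolding connected_graph_def by blast
  have "P {r}" using r grown.single by (auto simp: P_def)
  moreover have "\<forall>S. P S \<longrightarrow> card S < Suc (card W)"
    using assms(2) by (auto simp: P_def less_Suc_eq_le card_mono)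
  ultimately obtain S where S: "P S" and max: "\<And>S'. P S' \<Longrightarrow> card S' \<le> card S"
    using ex_has_greatest_nat[of P _ card] by metis
  have "W \<subseteq> S"
  proof
    fix y assume y: "y \<in> W"
    show "y \<in> S"
    proof (rule ccontr)
      assume "y \<notin> S"
      have "S \<noteq> {}" using S unfolding P_def by (auto elim: grown.cases)
      then obtain x where "x \<in> S" by blast
      then have "reach W F x y" using y S assms(1) unfolding P_def connected_graph_def by blast
      then obtain a b where ab: "a \<in> S" "b \<in> W" "b \<notin> S" "{a, b} \<in> F"
        using reach_exit[OF _ \<open>x \<in> S\<close> \<open>y \<notin> S\<close>] by blast
      then have "P (insert b S)"
        using S grown.step[of F S a b] unfolding P_def by (auto simp: insert_commute)
      then have "card (insert b S) \<le> card S" by (rule max)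
      moreover have "finite S" using S unfolding P_def by (blast intro: grown_finite)
      ultimately show False using ab(3) by auto
    qed
  qed
  then show ?thesis using S unfolding P_def by auto
qed

definition star :: "'a \<Rightarrow> 'a set \<Rightarrow> 'a set set" where
  "star v S = (\<lambda>x. {v, x}) ` S"

text \<open>The set \<open>L\<close> consists of leaves still waiting to be paired, at most one per parent.
  Removing the last vertex \<open>u\<close> of the growth order, we pair it with its own waiting leaf, or else
  with the leaf waiting at its parent, or else let it wait there itself.\<close>

lemma grown_packs:
  assumes "grown F S" "finite L" "L \<inter> S = {}" "inj_on \<pi> L" "\<pi> ` L \<subseteq> S"
    "\<And>l. l \<in> L \<Longrightarrow> {l, \<pi> l} \<in> F" "v \<notin> S \<union> L"
  shows "packs (induced_edges F (S \<union> L) \<union> star v (S \<union> L)) ((card S + card L) div 2)"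
  using assms
proof (induction arbitrary: L \<pi> rule: grown.induct)
  case (single r)
  \<comment> \<open>Injectivity of \<open>\<pi>\<close> allows at most one leaf at the only vertex
    \<open>r\<close>; if there is one, it forms a triangle with \<open>r\<close> and
    \<open>v\<close>.\<close>
  have "card L = card (\<pi> ` L)" using single by (simp add: card_image)
  also have "\<dots> \<le> card {r}" using single by (intro card_mono) auto
  finally have "card L \<le> 1" by simp
  show ?case
  proof (cases "L = {}")
    case False
    then have "card L = 1" using \<open>card L \<le> 1\<close> single by (metis One_nat_def Suc_leI card_gt_0_iff le_antisym)
    then obtain l where l: "L = {l}" by (meson card_1_singletonE)
    then have "\<pi> l = r" "{l, r} \<in> F" "distinct [v, l, r]" using single by auto
    then have "packs {{v, l}, {l, r}, {v, r}} 1" by (intro packs_cycle cycle_set_3)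
    then show ?thesis
      using l \<open>{l, r} \<in> F\<close> by (auto intro: packs_mono simp: induced_edges_def star_def)
  qed (simp add: packs_0)
next
  case (step S w u)
  have S: "finite S" using step.hyps step.prems grown_finite by blast
  have cardI: "card (insert u S) = Suc (card S)" using S step by auto
  let ?E = "\<lambda>U. induced_edges F U \<union> star v U"
  consider (own) l where "l \<in> L" "\<pi> l = u"
    | (sib) l where "u \<notin> \<pi> ` L" "l \<in> L" "\<pi> l = w"
    | (wait) "u \<notin> \<pi> ` L" "w \<notin> \<pi> ` L" by blast
  then show ?case
  proof cases
    case (own l)
    \<comment> \<open>Once \<open>u\<close> and \<open>l\<close> are removed, their spokes and the
      edge between them are no longer available to the smaller packing.\<close>
    let ?L = "L - {l}" and ?X = "{{v, l}, {l, u}, {v, u}}"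
    have "\<pi> ` ?L \<subseteq> S"
    proof
      fix y assume "y \<in> \<pi> ` ?L"
      then obtain l' where "l' \<in> L" "l' \<noteq> l" "y = \<pi> l'" by blast
      moreover from this have "\<pi> l' \<noteq> u" using own step.prems(3) unfolding inj_on_def by metis
      ultimately show "y \<in> S" using step.prems(4) by blast
    qed
    then have "packs (?E (S \<union> ?L)) ((card S + card ?L) div 2)"
      using step.prems by (intro step.IH[of ?L \<pi>]) (auto intro: inj_on_subset)
    moreover have "packs ?X 1"
      using own step.prems by (intro packs_cycle cycle_set_3) auto
    moreover have "?E (S \<union> ?L) \<inter> ?X = {}"
      using own step.hyps step.prems by (auto simp: induced_edges_def star_def doubleton_eq_iff)
    ultimately have "packs (?E (S \<union> ?L) \<union> ?X) ((card S + card ?L) div 2 + 1)"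
      by (intro packs_Un)
    then have "packs (?E (insert u S \<union> L)) ((card S + card ?L) div 2 + 1)"
      by (rule packs_mono) (use own step.prems(5)[of l] in \<open>auto simp: induced_edges_def star_def\<close>)
    moreover have "(card S + card ?L) div 2 + 1 = (card (insert u S) + card L) div 2"
    proof -
      have "card L = Suc (card ?L)" using own step.prems(1) by (simp only: card.remove)
      then show ?thesis unfolding cardI by presburger
    qed
    ultimately show ?thesis by (simp only:)
  next
    case (sib l)
    \<comment> \<open>This 4-cycle passes through the parent \<open>w\<close> without using the
      spoke of \<open>w\<close>, which is left to the smaller packing.\<close>
    let ?L = "L - {l}" and ?X = "{{v, u}, {u, w}, {w, l}, {v, l}}"
    have "\<pi> ` ?L \<subseteq> S" using step.prems sib by auto
    then have "packs (?E (S \<union> ?L)) ((card S + card ?L) div 2)"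
      using step.prems by (intro step.IH[of ?L \<pi>]) (auto intro: inj_on_subset)
    moreover have "packs ?X 1"
      using sib step.hyps step.prems by (intro packs_cycle cycle_set_4) auto
    moreover have "?E (S \<union> ?L) \<inter> ?X = {}"
      using sib step.hyps step.prems by (auto simp: induced_edges_def star_def doubleton_eq_iff)
    ultimately have "packs (?E (S \<union> ?L) \<union> ?X) ((card S + card ?L) div 2 + 1)"
      by (intro packs_Un)
    then have "packs (?E (insert u S \<union> L)) ((card S + card ?L) div 2 + 1)"
      by (rule packs_mono) (use sib step.hyps step.prems(5)[of l] in \<open>auto simp: induced_edges_def star_def insert_commute\<close>)
    moreover have "(card S + card ?L) div 2 + 1 = (card (insert u S) + card L) div 2"
    proof -
      have "card L = Suc (card ?L)" using sib step.prems(1) by (simp only: card.remove)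
      then show ?thesis unfolding cardI by presburger
    qed
    ultimately show ?thesis by (simp only:)
  next
    case wait
    \<comment> \<open>Moving \<open>u\<close> from the grown set to the leaves changes neither the
      union of the two sets nor the sum of their sizes.\<close>
    let ?\<pi> = "\<pi>(u := w)"
    have uL: "u \<notin> L" using step.prems by auto
    have "packs (?E (S \<union> insert u L)) ((card S + card (insert u L)) div 2)"
    proof (rule step.IH[of "insert u L" ?\<pi>])
      show "inj_on ?\<pi> (insert u L)"
        using step.prems wait uL by (auto simp: inj_on_def)
      show "?\<pi> ` insert u L \<subseteq> S" using step.hyps step.prems wait uL by auto
      show "{l, ?\<pi> l} \<in> F" if "l \<in> insert u L" for l using that step.hyps step.prems uL by auto
    qed (use step.hyps step.prems uL in auto)
    then show ?thesis unfolding cardI using uL step.prems(1) by simp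
  qed
qed

lemma connected_packs:
  fixes W :: "'a set"
  assumes "connected_graph W F" "finite W" "v \<notin> W"
  shows "packs (induced_edges F W \<union> star v W) (card W div 2)"
proof -
  have "packs (induced_edges F (W \<union> {}) \<union> star v (W \<union> {})) ((card W + card ({} :: 'a set)) div 2)"
    by (rule grown_packs[where \<pi> = id]) (use connected_graph_grown assms in auto)
  then show ?thesis by simp
qed

text \<open>All quantities add up over components. A connected graph on \<open>m \<ge> 2\<close>
  vertices has \<open>n = m div 2\<close> cycles, and its number of edges is at most
  \<open>(3 m - 4) / 2 < 3 n\<close> for even \<open>m\<close> and, by integrality, at most
  \<open>(3 m - 5) / 2 < 3 n\<close> for odd \<open>m\<close>. A single vertex has no edge and
  \<open>n = 0\<close>.\<close>

lemma triangle_theta_free_packs: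
  assumes "simple_graph W F" "theta_free F" "triangle_free F" "v \<notin> W"
  shows "\<exists>n. packs (F \<union> star v W) n \<and> card F \<le> 3 * n \<and> (F \<noteq> {} \<longrightarrow> card F < 3 * n)"
  using assms
proof (induction "card W" arbitrary: W F rule: less_induct)
  case (less W F)
  have fin: "finite W" "finite F" using simple_graph_finite[OF less.prems(1)] by auto
  show ?case
  proof (cases "connected_graph W F")
    case True
    then have "W \<noteq> {}" by (simp add: connected_graph_def)
    have "induced_edges F W = F" using less.prems(1) by (auto simp: induced_edges_def simple_graph_def)
    then have "packs (F \<union> star v W) (card W div 2)"
      using connected_packs[OF True fin(1) less.prems(4)] by simp
    moreover have "2 * card F + 3 \<le> 3 * card W" "2 \<le> card W \<longrightarrow> 2 * card F + 4 \<le> 3 * card W"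
      using card_triangle_theta_free less.prems \<open>W \<noteq> {}\<close> by blast+
    moreover have "2 \<le> card W" if "F \<noteq> {}"
    proof -
      from that obtain e where "e \<in> F" by blast
      then show ?thesis using less.prems(1) fin(1) card_mono[of W e] unfolding simple_graph_def by auto
    qed
    ultimately show ?thesis
      by (intro exI[of _ "card W div 2"]; cases "F = {}") auto
  next
    case False
    show ?thesis
    proof (cases "W = {}")
      case True
      then have "F = {}" using less.prems(1) unfolding simple_graph_def by fastforce
      then show ?thesis using packs_0 by (intro exI[of _ 0]) auto
    next
      case nonempty: False
      then obtain x y where xy: "x \<in> W" "y \<in> W" "\<not> reach W F x y"
        using False unfolding connected_graph_def by blast
      \<comment> \<open>The component of \<open>x\<close> and the rest. Being vertex-disjoint, they
        also use disjoint sets of spokes.\<close>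
      define A B where "A = {z\<in>W. reach W F x z}" and "B = W - A"
      have AB: "A \<subset> W" "B \<subset> W" "A \<union> B = W" "A \<inter> B = {}"
        using xy unfolding A_def B_def by (blast intro: reach_refl)+
      have split: "F = induced_edges F A \<union> induced_edges F B"
      proof
        show "F \<subseteq> induced_edges F A \<union> induced_edges F B"
        proof
          fix e assume "e \<in> F"
          then obtain s t where st: "e = {s, t}" "s \<in> W" "t \<in> W" using simple_graphE[OF less.prems(1)] by metis
          have closed: "t' \<in> A" if "{s', t'} \<in> F" "s' \<in> A" "t' \<in> W" for s' t'
            using that reach_step[of W F x s' t'] unfolding A_def by blast
          have "s \<in> A \<longleftrightarrow> t \<in> A"
            using closed[of s t] closed[of t s] st \<open>e \<in> F\<close> by (auto simp: insert_commute)
          then show "e \<in> induced_edges F A \<union> induced_edges F B"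
            using st \<open>e \<in> F\<close> unfolding induced_edges_def B_def by blast
        qed
      qed (auto simp: induced_edges_def)
      have IH: "\<exists>n. packs (induced_edges F U \<union> star v U) n \<and> card (induced_edges F U) \<le> 3 * n \<and>
          (induced_edges F U \<noteq> {} \<longrightarrow> card (induced_edges F U) < 3 * n)" if "U \<subset> W" for U
      proof (rule less.hyps)
        show "card U < card W" using that fin psubset_card_mono by blast
        show "simple_graph U (induced_edges F U)" using simple_graph_induced less.prems that by blast
        have "induced_edges F U \<subseteq> F" by (auto simp: induced_edges_def)
        then show "theta_free (induced_edges F U)" "triangle_free (induced_edges F U)"
          using less.prems theta_free_mono triangle_free_mono by blast+
        show "v \<notin> U" using that less.prems by blast
      qed
      obtain m n where m: "packs (induced_edges F A \<union> star v A) m" "card (induced_edges F A) \<le> 3 * m"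
          "induced_edges F A \<noteq> {} \<longrightarrow> card (induced_edges F A) < 3 * m"
        and n: "packs (induced_edges F B \<union> star v B) n" "card (induced_edges F B) \<le> 3 * n"
          "induced_edges F B \<noteq> {} \<longrightarrow> card (induced_edges F B) < 3 * n"
        using IH[OF AB(1)] IH[OF AB(2)] by blast
      have disj: "e \<notin> induced_edges F B" if "e \<in> induced_edges F A" for e
      proof
        assume "e \<in> induced_edges F B"
        then have "e \<subseteq> A \<inter> B" "e \<in> F" using that by (auto simp: induced_edges_def)
        then show False using AB less.prems(1) unfolding simple_graph_def by fastforce
      qed
      have "(induced_edges F A \<union> star v A) \<inter> (induced_edges F B \<union> star v B) = {}"
        using disj AB less.prems(4) by (auto simp: star_def induced_edges_def doubleton_eq_iff)
      then have "packs ((induced_edges F A \<union> star v A) \<union> (induced_edges F B \<union> star v B)) (m + n)"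
        using m n by (intro packs_Un)
      moreover have "(induced_edges F A \<union> star v A) \<union> (induced_edges F B \<union> star v B) = F \<union> star v W"
        unfolding AB(3)[symmetric] star_def image_Un by (subst (3) split) auto
      ultimately have "packs (F \<union> star v W) (m + n)" by metis
      moreover have "card F = card (induced_edges F A) + card (induced_edges F B)"
        by (subst split, rule card_Un_disjoint) (use disj fin in \<open>auto simp: induced_edges_def\<close>)
      moreover have "F \<noteq> {} \<Longrightarrow> induced_edges F A \<noteq> {} \<or> induced_edges F B \<noteq> {}"
        using split by blast
      ultimately show ?thesis using m(2,3) n(2,3) by (intro exI[of _ "m + n"]) auto
    qed
  qed
qed

section \<open>Partitions of the edge set into triangles\<close>

text \<open>The complete graph on any set, not only on a triple: for a single edge \<open>e\<close>
  it is \<open>{e}\<close>, so edges and triangles can be handled alike.\<close>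

definition all_pairs :: "'a set \<Rightarrow> 'a set set" where
  "all_pairs T = {{x, y} | x y. x \<in> T \<and> y \<in> T \<and> x \<noteq> y}"

lemma in_all_pairs_iff: "e \<in> all_pairs T \<longleftrightarrow> e \<subseteq> T \<and> card e = 2"
  unfolding all_pairs_def by (auto simp: card_2_iff)

lemma doubleton_in_all_pairs: "{x, y} \<in> all_pairs T \<longleftrightarrow> x \<in> T \<and> y \<in> T \<and> x \<noteq> y"
  by (auto simp: in_all_pairs_iff card_insert_if)

lemma all_pairs_triple:
  "distinct [x, y, z] \<Longrightarrow> all_pairs {x, y, z} = {{x, y}, {y, z}, {x, z}}"
  unfolding all_pairs_def by (auto simp: insert_commute)

lemma card_all_pairs_triple:
  assumes "card T = 3"
  shows "card (all_pairs T) = 3"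
proof -
  obtain x y z where T: "T = {x, y, z}" "distinct [x, y, z]"
    using assms by (auto simp: card_3_iff)
  then have "card {{x, y}, {y, z}, {x, z}} = 3" by (auto simp: card_insert_if doubleton_eq_iff)
  then show ?thesis using T all_pairs_triple by metis
qed

lemma cycle_set_all_pairs: "card T = 3 \<Longrightarrow> cycle_set (all_pairs T)"
proof -
  assume "card T = 3"
  then obtain x y z where "T = {x, y, z}" "distinct [x, y, z]" by (auto simp: card_3_iff)
  then show ?thesis using cycle_set_3 all_pairs_triple by metis
qed

lemma triple_apex:
  assumes "card T = 3" "card e = 2" "e \<subseteq> T"
  obtains p where "p \<notin> e" "T = insert p e"
proof -
  have "finite e" using assms by (auto intro: card_ge_0_finite)
  then have "card (T - e) = 1" using assms by (simp add: card_Diff_subset)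
  then obtain p where "T - e = {p}" by (meson card_1_singletonE)
  then show thesis using that[of p] assms(3) by blast
qed

text \<open>Edge-disjointness takes the form in which it is applied: the member through a given pair
  is unique. Members may share single vertices.\<close>

definition triangle_partition :: "'a set set \<Rightarrow> 'a set set \<Rightarrow> bool" where
  "triangle_partition F \<T> \<longleftrightarrow> finite \<T> \<and> (\<forall>T\<in>\<T>. card T = 3) \<and> F = \<Union> (all_pairs ` \<T>) \<and>
     (\<forall>T\<in>\<T>. \<forall>T'\<in>\<T>. \<forall>e. card e = 2 \<longrightarrow> e \<subseteq> T \<longrightarrow> e \<subseteq> T' \<longrightarrow> T = T')"

lemma triangle_partition_unique:
  "triangle_partition F \<T> \<Longrightarrow> T \<in> \<T> \<Longrightarrow> T' \<in> \<T> \<Longrightarrow> {x, y} \<subseteq> T \<Longrightarrow> {x, y} \<subseteq> T' \<Longrightarrow> x \<noteq> y \<Longrightarrow> T = T'"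
  unfolding triangle_partition_def by (metis card_2_iff)

lemma triangle_partition_edge:
  "triangle_partition F \<T> \<Longrightarrow> T \<in> \<T> \<Longrightarrow> x \<in> T \<Longrightarrow> y \<in> T \<Longrightarrow> x \<noteq> y \<Longrightarrow> {x, y} \<in> F"
  using doubleton_in_all_pairs[of x y T] unfolding triangle_partition_def by blast

lemma triangle_partition_disjoint:
  "triangle_partition F \<T> \<Longrightarrow> T \<in> \<T> \<Longrightarrow> T' \<in> \<T> \<Longrightarrow> T \<noteq> T' \<Longrightarrow> all_pairs T \<inter> all_pairs T' = {}"
  unfolding triangle_partition_def in_all_pairs_iff disjoint_iff by blast

lemma triangle_partition_card:
  assumes "triangle_partition F \<T>"
  shows "card F = 3 * card \<T>"
proof -
  have T: "finite \<T>" "\<And>T. T \<in> \<T> \<Longrightarrow> card T = 3" "F = (\<Union>T\<in>\<T>. all_pairs T)"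
    using assms by (auto simp: triangle_partition_def)
  have "finite (all_pairs T)" if "T \<in> \<T>" for T
    using card_all_pairs_triple[OF T(2)[OF that]] by (auto intro: card_ge_0_finite)
  then have "card F = (\<Sum>T\<in>\<T>. card (all_pairs T))"
    unfolding T(3) using T(1) triangle_partition_disjoint[OF assms] by (intro card_UN_disjoint) auto
  also have "\<dots> = (\<Sum>T\<in>\<T>. 3)" by (intro sum.cong) (auto simp: card_all_pairs_triple T)
  finally show ?thesis by simp
qed

lemma triangle_partition_packs:
  assumes "triangle_partition F \<T>" "\<S> \<subseteq> \<T>"
  shows "packs (\<Union> (all_pairs ` \<S>)) (card \<S>)"
proof (rule packs_UN)
  show "finite \<S>" using assms finite_subset unfolding triangle_partition_def by blast
  show "cycle_set (all_pairs T)" if "T \<in> \<S>" for T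
    using that assms cycle_set_all_pairs unfolding triangle_partition_def by blast
  show "all_pairs T \<inter> all_pairs T' = {}" if "T \<in> \<S>" "T' \<in> \<S>" "T \<noteq> T'" for T T'
    using triangle_partition_disjoint[OF assms(1)] that assms(2) by blast
qed

lemma maximal_triangle_packing:
  assumes "finite F"
  shows "\<exists>\<T> F'. F' \<subseteq> F \<and> triangle_partition (F - F') \<T> \<and> triangle_free F'"
  using assms
proof (induction "card F" arbitrary: F rule: less_induct)
  case (less F)
  show ?case
  proof (cases "triangle_free F")
    case True
    have "triangle_partition (F - F) {}" by (simp add: triangle_partition_def)
    then show ?thesis using True by blast
  next
    case False
    then obtain x y z where "distinct [x, y, z]" "{x, y} \<in> F" "{y, z} \<in> F" "{x, z} \<in> F"
      unfolding triangle_free_def by auto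
    moreover define T where "T = {x, y, z}"
    ultimately have T: "card T = 3" "all_pairs T \<subseteq> F"
      using all_pairs_triple[of x y z] by auto
    have "all_pairs T \<noteq> {}" using card_all_pairs_triple[OF T(1)] by auto
    then have "card (F - all_pairs T) < card F"
      using T(2) less.prems by (intro psubset_card_mono) auto
    then obtain \<T> F' where IH: "F' \<subseteq> F - all_pairs T" "triangle_partition (F - all_pairs T - F') \<T>" "triangle_free F'"
      using less.hyps[of "F - all_pairs T"] less.prems by blast
    have "triangle_partition (F - F') (insert T \<T>)"
    proof -
      have new: "False" if "S \<in> \<T>" "e \<subseteq> S" "e \<subseteq> T" "card e = 2" for S e
      proof -
        have "e \<in> all_pairs S" "e \<in> all_pairs T" using that by (auto simp: in_all_pairs_iff)
        then show False using IH(2) that(1) unfolding triangle_partition_def by blast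
      qed
      have "\<Union> (all_pairs ` \<T>) = F - all_pairs T - F'" using IH(2) unfolding triangle_partition_def by simp
      then have "F - F' = \<Union> (all_pairs ` insert T \<T>)" using IH(1) T(2) by auto
      then show ?thesis using IH(2) T(1) new unfolding triangle_partition_def by (metis finite_insert insert_iff)
    qed
    then show ?thesis using IH by blast
  qed
qed

lemma star_disjoint: "v \<notin> W \<Longrightarrow> \<forall>e\<in>F. e \<subseteq> W \<Longrightarrow> F \<inter> star v S = {}"
  by (auto simp: star_def)

text \<open>The packed triangles and the \<open>n\<close> cycles from the rest \<open>F'\<close>
  give \<open>card \<T> + n \<le> k - 1\<close>, while
  \<open>card F = 3 * card \<T> + card F' \<le> 3 * (card \<T> + n)\<close>. A nonempty rest makes
  the last inequality strict, so equality leaves nothing but triangles.\<close>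

lemma card_edges_le_if_no_packing:
  assumes "simple_graph W F" "theta_free F" "v \<notin> W" "\<not> packs (F \<union> star v W) k" "1 \<le> k"
  shows "card F \<le> 3 * (k - 1) \<and>
    (card F = 3 * (k - 1) \<longrightarrow> (\<exists>\<T>. triangle_partition F \<T> \<and> card \<T> = k - 1))"
proof -
  have fin: "finite F" using simple_graph_finite assms by blast
  have inW: "\<forall>e\<in>F. e \<subseteq> W" using assms(1) by (auto simp: simple_graph_def)
  obtain \<T> F' where F': "F' \<subseteq> F" "triangle_partition (F - F') \<T>" "triangle_free F'"
    using maximal_triangle_packing[OF fin] by blast
  have "simple_graph W F'" using F' assms(1) by (auto simp: simple_graph_def)
  then obtain n where n: "packs (F' \<union> star v W) n" "card F' \<le> 3 * n" "F' \<noteq> {} \<longrightarrow> card F' < 3 * n"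
    using triangle_theta_free_packs[of W F' v] F' theta_free_mono[OF assms(2)] assms(3) by blast
  have "packs (F - F') (card \<T>)"
    using triangle_partition_packs[OF F'(2) subset_refl] F'(2) unfolding triangle_partition_def by simp
  moreover have "(F - F') \<inter> (F' \<union> star v W) = {}" using star_disjoint[OF assms(3) inW] by blast
  ultimately have "packs ((F - F') \<union> (F' \<union> star v W)) (card \<T> + n)" using n(1) by (intro packs_Un)
  then have "packs (F \<union> star v W) (card \<T> + n)" by (rule packs_mono) (use F'(1) in auto)
  then have "card \<T> + n < k" using packs_le assms(4) by (metis not_le_imp_less)
  moreover have "card F = 3 * card \<T> + card F'"
    using triangle_partition_card[OF F'(2)] card_Diff_subset[of F' F] card_mono[OF fin F'(1)] F'(1)
      finite_subset[OF F'(1) fin] by linarith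
  ultimately have "card F \<le> 3 * (k - 1)" "card F = 3 * (k - 1) \<longrightarrow> F' = {} \<and> card \<T> = k - 1"
    using n(2,3) by auto
  then show ?thesis using F'(2) by auto
qed

section \<open>Exchanging triangles along a shortest cycle outside the partition\<close>

lemma graph_cycle_rotate_edge:
  assumes "graph_cycle E c" "i < length c"
  shows "\<exists>q. graph_cycle E (c ! i # c ! ((i + 1) mod length c) # q) \<and>
    set (c ! i # c ! ((i + 1) mod length c) # q) = set c \<and>
    length (c ! i # c ! ((i + 1) mod length c) # q) = length c \<and>
    cycle_edges (c ! i # c ! ((i + 1) mod length c) # q) = cycle_edges c"
proof -
  \<comment> \<open>Starting the cycle at index \<open>i\<close> puts the chosen edge at the head of
    the list.\<close>
  define d where "d = rotate i c"
  have "cycle_edges d = cycle_edges c"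
    unfolding d_def rotate_drop_take using cycle_edges_rotate append_take_drop_id by metis
  moreover have "length d = length c" "set d = set c" "distinct d"
    using assms by (auto simp: d_def graph_cycle_def)
  moreover have "d ! 0 = c ! i" "d ! 1 = c ! ((i + 1) mod length c)"
  proof -
    have "0 < length c" "1 < length c" using assms by (auto simp: graph_cycle_def)
    then show "d ! 0 = c ! i" "d ! 1 = c ! ((i + 1) mod length c)"
      using assms(2) nth_rotate[of 0 c i] nth_rotate[of 1 c i] by (simp_all add: d_def)
  qed
  moreover obtain a b q where "d = a # b # q"
    using \<open>length d = length c\<close> assms(1) unfolding graph_cycle_def
    by (metis Suc_le_length_iff numeral_3_eq_3)
  ultimately show ?thesis using assms(1) unfolding graph_cycle_def by (intro exI[of _ q]) auto
qed

lemma path_edges_split: "e \<in> path_edges xs \<Longrightarrow> \<exists>s1 a b s2. xs = s1 @ a # b # s2 \<and> e = {a, b}"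
proof (induction xs rule: path_edges.induct)
  case (1 x y xs)
  show ?case
  proof (cases "e = {x, y}")
    case True then show ?thesis by (intro exI[of _ "[]"]) auto
  next
    case False
    then obtain s1 a b s2 where "y # xs = s1 @ a # b # s2" "e = {a, b}" using 1 by auto
    then show ?thesis by (intro exI[of _ "x # s1"]) auto
  qed
qed auto

context
  fixes F \<T> :: "'a set set" and c :: "'a list"
  assumes partition: "triangle_partition F \<T>"
    and cycle: "graph_cycle F c" and not_member: "set c \<notin> \<T>"
    and shortest: "\<And>c'. graph_cycle F c' \<Longrightarrow> length c' < length c \<Longrightarrow> set c' \<in> \<T>"
begin

text \<open>A shorter cycle spans a member by minimality of \<open>c\<close>, and only one member
  contains both \<open>a\<close> and \<open>b\<close>.\<close>

lemma shorter_cycle_eq: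
  assumes "graph_cycle F c'" "length c' < length c" "{a, b} \<subseteq> set c'" "a \<noteq> b" "T \<in> \<T>" "{a, b} \<subseteq> T"
  shows "set c' = T"
  using triangle_partition_unique[OF partition _ assms(5,3,6,4)] shortest assms by blast

text \<open>An apex \<open>p\<close> on the cycle would be joined to both ends of
  \<open>e = {x, y}\<close>. These edges cut off shorter cycles which share a pair with the triangle
  \<open>{p, x, y}\<close> and so would have to coincide with it, although each misses
  \<open>x\<close> or \<open>y\<close>. If no such cycle exists, \<open>c\<close> is that triangle
  itself.\<close>

lemma apex_notin_cycle:
  assumes "e \<in> cycle_edges c" "p \<notin> e" "insert p e \<in> \<T>"
  shows "p \<notin> set c"
proof
  assume p: "p \<in> set c"
  obtain i where "i < length c" "e = {c ! i, c ! ((i + 1) mod length c)}"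
    using assms(1) unfolding cycle_edges_def by blast
  then obtain x y q where c': "graph_cycle F (x # y # q)" "set (x # y # q) = set c"
    "length (x # y # q) = length c" and e: "e = {x, y}"
    using graph_cycle_rotate_edge[OF cycle] by metis
  have T: "{p, x, y} \<in> \<T>" "p \<noteq> x" "p \<noteq> y" using assms e by auto
  have dist: "distinct (x # y # q)" using c' by (simp add: graph_cycle_def)
  have edges: "{x, p} \<in> F" "{y, p} \<in> F" "{p, x} \<in> F" "{p, y} \<in> F"
    using triangle_partition_edge[OF partition T(1)] T(2,3) by auto
  obtain q1 q2 where q: "q = q1 @ p # q2" using p c'(2) T by (metis set_ConsD split_list)
  note cyc = c'(1)[unfolded graph_cycle_Cons q]
  show False
  proof (cases "q1 = []")
    case False
    \<comment> \<open>This cycle bypasses \<open>x\<close>; the one built from \<open>q2\<close> in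
      the other case bypasses \<open>y\<close>.\<close>
    have "graph_cycle F (y # q1 @ [p])"
      using cyc False edges unfolding graph_cycle_Cons
      by (auto simp: adj_walk_Cons adj_walk_append hd_append Suc_le_eq split: if_splits)
    then have "set (y # q1 @ [p]) = {p, x, y}"
      using c'(3) q T by (intro shorter_cycle_eq[of _ y p]) auto
    then show False using dist T(2) unfolding q by auto
  next
    case True
    show False
    proof (cases "q2 = []")
      case True
      then show False using \<open>q1 = []\<close> q c'(2) T(1) not_member by (auto simp: insert_commute)
    next
      case False
      have "graph_cycle F (p # q2 @ [x])"
        using cyc False True edges unfolding graph_cycle_Cons
        by (auto simp: adj_walk_Cons adj_walk_append hd_append Suc_le_eq split: if_splits)
      then have "set (p # q2 @ [x]) = {p, x, y}"
        using c'(3) q True T by (intro shorter_cycle_eq[of _ x p]) auto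
      then show False using dist T(3) unfolding q True by auto
    qed
  qed
qed

text \<open>Edges of \<open>c\<close> with a common apex \<open>p\<close> cannot share an end, since
  their triangles would share an edge. For disjoint edges, a detour through \<open>p\<close>
  replaces a stretch of \<open>c\<close> with at least two vertices and yields a shorter cycle that
  meets one of the triangles in an edge but is not that triangle.\<close>

lemma apex_inj:
  assumes "e \<in> cycle_edges c" "p \<notin> e" "insert p e \<in> \<T>"
    and "e' \<in> cycle_edges c" "p \<notin> e'" "insert p e' \<in> \<T>"
  shows "e = e'"
proof (rule ccontr)
  assume "e \<noteq> e'"
  have p: "p \<notin> set c" using apex_notin_cycle assms by blast
  obtain i where "i < length c" "e = {c ! i, c ! ((i + 1) mod length c)}"
    using assms(1) unfolding cycle_edges_def by blast
  then obtain x y q where c': "graph_cycle F (x # y # q)" "set (x # y # q) = set c"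
    "length (x # y # q) = length c" "cycle_edges (x # y # q) = cycle_edges c" and e: "e = {x, y}"
    using graph_cycle_rotate_edge[OF cycle] by metis
  have dist: "distinct (x # y # q)" "q \<noteq> []" using c' by (auto simp: graph_cycle_def)
  \<comment> \<open>Being different from \<open>{x, y}\<close>, the edge \<open>e'\<close> lies on
    the remaining path of the cycle from \<open>y\<close> round to \<open>x\<close>.\<close>
  have "e' \<in> path_edges (y # q @ [x])"
    using assms(4) \<open>e \<noteq> e'\<close> dist unfolding c'(4)[symmetric] e
    using path_edges_append[of "y # q" "[x]"] by (auto simp: cycle_edges_Cons)
  then obtain s1 a b s2 where s: "y # q @ [x] = s1 @ a # b # s2" "e' = {a, b}"
    using path_edges_split by blast
  have ab: "a \<in> set c" "b \<in> set c" "a \<noteq> b"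
  proof -
    have "distinct (y # q @ [x])" using dist by auto
    then show "a \<noteq> b" unfolding s by auto
    have "a \<in> set (y # q @ [x])" "b \<in> set (y # q @ [x])" unfolding s by auto
    then show "a \<in> set c" "b \<in> set c" unfolding c'(2)[symmetric] by auto
  qed
  have T: "{p, x, y} \<in> \<T>" "{p, a, b} \<in> \<T>" "p \<noteq> x" "p \<noteq> y" "p \<noteq> a" "p \<noteq> b" "x \<noteq> y"
    using assms e s dist by auto
  \<comment> \<open>A common end \<open>z\<close> would put the pair \<open>{p, z}\<close> into both
    triangles.\<close>
  have shared: False if "z \<in> {x, y}" "z \<in> {a, b}" for z
  proof -
    have "insert p e = insert p e'"
      unfolding e s(2) by (rule triangle_partition_unique[OF partition T(1,2), of p z]) (use that T in auto)
    then show False using \<open>e \<noteq> e'\<close> assms(2,5) insert_ident by metis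
  qed
  have sep: "x \<noteq> a" "x \<noteq> b" "y \<noteq> a" "y \<noteq> b"
    using shared by auto
  obtain s1' where s1: "s1 = y # s1'" using s(1) sep by (cases s1) auto
  have "s2 \<noteq> []"
    using s(1) sep last_snoc[of "y # q" x] by auto
  then obtain s2' where s2: "s2 = s2' @ [x]"
    using s(1) by (metis append_Cons append_butlast_last_id last_appendR last_ConsR last_snoc list.discI)
  have q: "q = s1' @ a # b # s2'" using s(1) unfolding s1 s2 by auto
  have edges: "{p, y} \<in> F" "{a, p} \<in> F"
    using triangle_partition_edge[OF partition T(1), of p y] triangle_partition_edge[OF partition T(2), of a p] T by auto
  \<comment> \<open>Compared with \<open>c\<close>, it gains \<open>p\<close> but loses at least
    \<open>x\<close> and \<open>b\<close>. It shares the pair \<open>{p, y}\<close> with the first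
    triangle, yet contains \<open>a\<close>.\<close>
  have "graph_cycle F (p # y # s1' @ [a])"
    using c'(1)[unfolded graph_cycle_Cons q] edges p T unfolding graph_cycle_Cons c'(2)[symmetric] q
    by (auto simp: adj_walk_Cons adj_walk_append hd_append Suc_le_eq split: if_splits)
  then have "set (p # y # s1' @ [a]) = {p, x, y}"
    using c'(3) q T by (intro shorter_cycle_eq[of _ y p]) auto
  then show False using sep T(5) by auto
qed

text \<open>Every edge \<open>e\<close> of \<open>c\<close> lies in its own triangle
  \<open>T e\<close> with its own apex \<open>p e\<close> off the cycle. In place of these triangles
  the packing takes \<open>c\<close> itself and, for each \<open>e\<close>, a triangle through
  \<open>v\<close> built on a remaining edge of \<open>T e\<close>. This gains exactly the cycle
  \<open>c\<close>.\<close>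

lemma packs_extra_cycle:
  assumes "\<forall>e\<in>F. e \<subseteq> W" "v \<notin> W"
  shows "packs (F \<union> star v W) (Suc (card \<T>))"
proof -
  define Z where "Z = cycle_edges c"
  have ZF: "Z \<subseteq> F" and finZ: "finite Z" using cycle by (auto simp: Z_def graph_cycle_def)
  have Zc: "e \<subseteq> set c" if "e \<in> Z" for e using that cycle_edges_vertices unfolding Z_def by blast
  have cW: "set c \<subseteq> W"
  proof
    fix x assume "x \<in> set c"
    then obtain e where "e \<in> cycle_edges c" "x \<in> e" using cycle_edges_cover by metis
    then show "x \<in> W" using ZF assms(1) unfolding Z_def by blast
  qed
  have "\<forall>e\<in>Z. \<exists>i. i < length c \<and> e = {c ! i, c ! ((i + 1) mod length c)}"
    by (auto simp: Z_def cycle_edges_def)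
  then obtain i where i: "\<And>e. e \<in> Z \<Longrightarrow> i e < length c \<and> e = {c ! i e, c ! ((i e + 1) mod length c)}"
    by metis
  \<comment> \<open>The tail of \<open>e\<close> when \<open>c\<close> is traversed in list order;
    distinct edges have distinct tails.\<close>
  define s where "s = (\<lambda>e. c ! i e)"
  have s: "s e \<in> e" "s e \<in> set c" if "e \<in> Z" for e using i[OF that] by (auto simp: s_def)
  have s_inj: "e = e'" if "e \<in> Z" "e' \<in> Z" "s e = s e'" for e e'
  proof -
    have "i e = i e'"
      using that i cycle unfolding s_def graph_cycle_def by (metis nth_eq_iff_index_eq)
    then show ?thesis using i that by metis
  qed
  have "\<exists>p. p \<notin> e \<and> insert p e \<in> \<T>" if "e \<in> Z" for e
  proof -
    have "e \<in> \<Union> (all_pairs ` \<T>)" using that ZF partition unfolding triangle_partition_def by blast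
    then obtain T where T: "T \<in> \<T>" "e \<in> all_pairs T" by blast
    then have "card T = 3" "card e = 2" "e \<subseteq> T"
      using partition by (auto simp: triangle_partition_def in_all_pairs_iff)
    then show ?thesis using triple_apex T(1) by metis
  qed
  then obtain p where p: "\<And>e. e \<in> Z \<Longrightarrow> p e \<notin> e \<and> insert (p e) e \<in> \<T>" by metis
  have pc: "p e \<notin> set c" if "e \<in> Z" for e
    using apex_notin_cycle that p unfolding Z_def by blast
  have p_inj: "e = e'" if "e \<in> Z" "e' \<in> Z" "p e = p e'" for e e'
    using apex_inj[of e "p e" e'] that p unfolding Z_def by metis
  define T where "T = (\<lambda>e. insert (p e) e)"
  have TT: "T e \<in> \<T>" if "e \<in> Z" for e using p that by (auto simp: T_def)
  have sp_in: "{s e, p e} \<in> all_pairs (T e)" if "e \<in> Z" for e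
    using s[OF that] p[OF that] by (auto simp: T_def doubleton_in_all_pairs)
  have T_F: "all_pairs (T e) \<subseteq> F" if "e \<in> Z" for e
    using TT[OF that] partition unfolding triangle_partition_def by blast
  have pW: "p e \<in> W" if "e \<in> Z" for e
    using sp_in[OF that] T_F[OF that] assms(1) by blast
  have sW: "s e \<in> W" if "e \<in> Z" for e using s(2)[OF that] cW by blast
  have e_in: "e \<in> all_pairs (T e)" if "e \<in> Z" for e
  proof -
    have "e \<in> \<Union> (all_pairs ` \<T>)" using that ZF partition unfolding triangle_partition_def by blast
    then obtain S where "e \<in> all_pairs S" by blast
    then show ?thesis by (auto simp: in_all_pairs_iff T_def)
  qed
  have T_inj: "inj_on T Z"
  proof (rule inj_onI)
    fix e e' assume e: "e \<in> Z" "e' \<in> Z" "T e = T e'"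
    have "p e \<in> insert (p e') e'" using e(3) unfolding T_def by blast
    then have "p e = p e'" using pc[OF e(1)] Zc[OF e(2)] by blast
    then show "e = e'" using p_inj e by blast
  qed
  \<comment> \<open>All tails lie on \<open>c\<close> and all apexes off \<open>c\<close>, so no two
    of these triangles use the same spoke.\<close>
  define X where "X = (\<lambda>e. {{v, s e}, {s e, p e}, {v, p e}})"
  have vc: "v \<notin> set c" using cW assms(2) by blast
  have vs: "v \<noteq> s e" "v \<noteq> p e" "s e \<noteq> p e" if "e \<in> Z" for e
    using sW[OF that] pW[OF that] assms(2) s(2)[OF that] pc[OF that] by auto
  let ?R = "\<T> - T ` Z"
  have "packs (\<Union>e\<in>Z. X e) (card Z)"
  proof (rule packs_UN[OF finZ])
    show "cycle_set (X e)" if "e \<in> Z" for e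
      unfolding X_def using vs[OF that] by (intro cycle_set_3) auto
    show "X e \<inter> X e' = {}" if "e \<in> Z" "e' \<in> Z" "e \<noteq> e'" for e e'
    proof -
      have "s e \<noteq> s e'" "p e \<noteq> p e'" "s e \<noteq> p e'" "p e \<noteq> s e'"
        using s_inj p_inj that s(2) pc by metis+
      then show ?thesis using vs[OF that(1)] vs[OF that(2)] unfolding X_def
        by (auto simp: doubleton_eq_iff)
    qed
  qed
  moreover have "packs Z 1"
    using cycle by (intro packs_cycle) (auto simp: cycle_set_def Z_def graph_cycle_def)
  moreover have "Z \<inter> (\<Union>e\<in>Z. X e) = {}"
  proof -
    have "f \<notin> X e" if "f \<in> Z" "e \<in> Z" for f e
      using Zc[OF that(1)] pc[OF that(2)] vc unfolding X_def by auto
    then show ?thesis by blast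
  qed
  ultimately have 1: "packs (Z \<union> (\<Union>e\<in>Z. X e)) (1 + card Z)" by (intro packs_Un)
  have 2: "packs (\<Union> (all_pairs ` ?R)) (card ?R)"
    by (rule triangle_partition_packs[OF partition]) auto
  have R_F: "\<Union> (all_pairs ` ?R) \<subseteq> F" using partition unfolding triangle_partition_def by blast
  have 3: "(Z \<union> (\<Union>e\<in>Z. X e)) \<inter> \<Union> (all_pairs ` ?R) = {}"
  proof -
    \<comment> \<open>The edges of \<open>c\<close> and the pairs \<open>{s e, p e}\<close> belong
      to the triangles \<open>T e\<close>, which share no edge with the members in
      \<open>?R\<close>. The spokes contain \<open>v\<close>, unlike every edge of
      \<open>F\<close>.\<close>
    have off: "f \<notin> all_pairs S" if "f \<in> all_pairs (T e)" "e \<in> Z" "S \<in> ?R" for f e S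
      using triangle_partition_disjoint[OF partition TT[OF that(2)], of S] that by blast
    have "f \<notin> all_pairs S" if "f \<in> X e" "e \<in> Z" "S \<in> ?R" for f e S
    proof (cases "v \<in> f")
      case True
      then show ?thesis using R_F assms that(3) by blast
    next
      case False
      then have "f = {s e, p e}" using that(1) unfolding X_def by auto
      then show ?thesis using off sp_in that by blast
    qed
    then show ?thesis using off e_in by blast
  qed
  have "packs ((Z \<union> (\<Union>e\<in>Z. X e)) \<union> \<Union> (all_pairs ` ?R)) (1 + card Z + card ?R)"
    using 1 2 3 by (rule packs_Un)
  moreover have "(Z \<union> (\<Union>e\<in>Z. X e)) \<union> \<Union> (all_pairs ` ?R) \<subseteq> F \<union> star v W"
  proof -
    have "X e \<subseteq> F \<union> star v W" if "e \<in> Z" for e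
      using sp_in[OF that] T_F[OF that] sW[OF that] pW[OF that] unfolding X_def star_def by auto
    then show ?thesis using ZF R_F by blast
  qed
  moreover have "1 + card Z + card ?R = Suc (card \<T>)"
  proof -
    have fin: "finite \<T>" using partition by (simp add: triangle_partition_def)
    have sub: "T ` Z \<subseteq> \<T>" using TT by blast
    have "card (T ` Z) = card Z" using T_inj card_image by blast
    then show ?thesis
      using card_Diff_subset[of "T ` Z" \<T>] card_mono[OF fin sub] sub finZ by simp
  qed
  ultimately show ?thesis using packs_mono by metis
qed

end

lemma graph_cycle_is_member:
  assumes "triangle_partition F \<T>" "simple_graph W F" "v \<notin> W"
    and "\<not> packs (F \<union> star v W) (Suc (card \<T>))" "graph_cycle F c"
  shows "set c \<in> \<T>"
proof (rule ccontr)
  assume "set c \<notin> \<T>"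
  then obtain d where d: "graph_cycle F d \<and> set d \<notin> \<T>"
    and min: "\<And>d'. length d' < length d \<Longrightarrow> \<not> (graph_cycle F d' \<and> set d' \<notin> \<T>)"
    using assms(5) exists_least_iff[of "\<lambda>n. \<exists>d. length d = n \<and> graph_cycle F d \<and> set d \<notin> \<T>"] by metis
  have "\<forall>e\<in>F. e \<subseteq> W" using assms(2) by (auto simp: simple_graph_def)
  then have "packs (F \<union> star v W) (Suc (card \<T>))"
    by (intro packs_extra_cycle[OF assms(1), of d]) (use d min assms(3) in simp_all)
  then show False using assms(4) by contradiction
qed

section \<open>Blocks and triangle-cacti\<close>

lemma reach_all_pairs_delete:
  assumes "u \<in> T" "w \<in> T" "u \<noteq> a" "w \<noteq> a" "all_pairs T \<subseteq> F" "T \<subseteq> W"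
  shows "reach (W - {a}) {e\<in>F. a \<notin> e} u w"
proof (cases "u = w")
  case False
  then have "{u, w} \<in> F" using assms doubleton_in_all_pairs[of u w T] by blast
  then show ?thesis using assms by (intro reach_edge) auto
qed simp

lemma no_cut_vertex_all_pairs: "\<not> cut_vertex T (all_pairs T) a"
  unfolding cut_vertex_def using reach_all_pairs_delete[of _ T _ a "all_pairs T" T] by blast

lemma connected_all_pairs_Un:
  assumes "x \<in> S \<inter> T"
  shows "connected_graph (S \<union> T) (all_pairs S \<union> all_pairs T)"
proof -
  let ?r = "reach (S \<union> T) (all_pairs S \<union> all_pairs T)"
  have "?r x y" if "y \<in> S \<union> T" for y
  proof (cases "x = y")
    case False
    then have "{x, y} \<in> all_pairs S \<union> all_pairs T" using that assms by (auto simp: doubleton_in_all_pairs)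
    then show ?thesis using that assms by (intro reach_edge) auto
  qed simp
  then show ?thesis
    using assms unfolding connected_graph_def by (blast intro: reach_sym reach_trans)
qed

lemma connected_all_pairs: "T \<noteq> {} \<Longrightarrow> connected_graph T (all_pairs T)"
  using connected_all_pairs_Un[of _ T T] by auto

text \<open>After deletion of \<open>a\<close> at least one of the two common vertices survives, and
  every remaining vertex is adjacent or equal to it.\<close>

lemma no_cut_vertex_all_pairs_Un:
  assumes "x \<in> S \<inter> T" "y \<in> S \<inter> T" "x \<noteq> y"
  shows "\<not> cut_vertex (S \<union> T) (all_pairs S \<union> all_pairs T) a"
proof -
  let ?F = "all_pairs S \<union> all_pairs T"
  let ?r = "reach (S \<union> T - {a}) {e\<in>?F. a \<notin> e}"
  obtain z where z: "z \<in> S" "z \<in> T" "z \<noteq> a" using assms by blast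
  have "?r u z" if "u \<in> S \<union> T - {a}" for u
  proof (cases "u \<in> S")
    case True
    then show ?thesis using that z by (intro reach_all_pairs_delete[of u S]) auto
  next
    case False
    then show ?thesis using that z by (intro reach_all_pairs_delete[of u T]) auto
  qed
  then show ?thesis unfolding cut_vertex_def by (blast intro: reach_sym reach_trans)
qed

lemma extend_to_block:
  assumes "simple_graph V E" "subgraph W F V E" "connected_graph W F" "\<And>x. \<not> cut_vertex W F x"
  obtains W' F' where "block V E W' F'" "W \<subseteq> W'" "F \<subseteq> F'"
proof -
  have fin: "finite V" "finite E" using simple_graph_finite[OF assms(1)] by auto
  define P where "P = (\<lambda>(W', F'). subgraph W' F' V E \<and> connected_graph W' F' \<and>
    (\<forall>x. \<not> cut_vertex W' F' x) \<and> W \<subseteq> W' \<and> F \<subseteq> F')"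
  \<comment> \<open>Blocks are maximal in vertices and edges at once, so the sum of both sizes is
    maximised.\<close>
  define m :: "'a set \<times> 'a set set \<Rightarrow> nat" where "m = (\<lambda>(W', F'). card W' + card F')"
  have "P (W, F)" using assms by (simp add: P_def)
  moreover have "\<forall>X. P X \<longrightarrow> m X < Suc (card V + card E)"
    using fin by (auto simp: P_def m_def subgraph_def less_Suc_eq_le intro!: add_mono card_mono)
  ultimately obtain X where X: "P X" and max: "\<And>Y. P Y \<Longrightarrow> m Y \<le> m X"
    using ex_has_greatest_nat[of P _ m] by metis
  obtain W' F' where X_eq: "X = (W', F')" by fastforce
  have P': "subgraph W' F' V E" "connected_graph W' F'" "\<forall>x. \<not> cut_vertex W' F' x" "W \<subseteq> W'" "F \<subseteq> F'"
    using X by (auto simp: P_def X_eq)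
  have "W'' = W' \<and> F'' = F'"
    if "subgraph W'' F'' V E" "connected_graph W'' F''" "\<forall>x. \<not> cut_vertex W'' F'' x" "W' \<subseteq> W''" "F' \<subseteq> F''"
    for W'' F''
  proof -
    have "P (W'', F'')" using that P' by (auto simp: P_def)
    then have le: "card W'' + card F'' \<le> card W' + card F'" using max unfolding X_eq m_def by fastforce
    have f: "finite W''" "finite F''" using that(1) fin finite_subset unfolding subgraph_def by blast+
    have "card W' \<le> card W''" "card F' \<le> card F''" using f that(4,5) by (auto intro: card_mono)
    then have "card W' = card W''" "card F' = card F''" using le by auto
    then show ?thesis using card_subset_eq f that(4,5) by metis
  qed
  then have "block V E W' F'" unfolding block_def using P' by blast
  then show thesis using that P' by blast
qed

lemma component_edge:
  assumes "C \<in> components W F" "{x, y} \<in> F" "x \<in> C" "y \<in> W"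
  shows "y \<in> C"
  using assms reach_step unfolding components_def by fast

lemma component_subset: "C \<in> components W F \<Longrightarrow> C \<subseteq> W"
  by (auto simp: components_def)

text \<open>Every vertex on a walk from \<open>r\<close> is itself reachable from \<open>r\<close>,
  so the walk never leaves \<open>C\<close>.\<close>

lemma component_connected:
  assumes "C \<in> components W F"
  shows "connected_graph C (induced_edges F C)"
proof -
  obtain r where r: "r \<in> W" "C = {y\<in>W. reach W F r y}" using assms by (auto simp: components_def)
  have "reach C (induced_edges F C) r y" if "reach W F r y" for y
    using that unfolding reach_def[of W F]
  proof (induction rule: rtranclp_induct)
    case (step y z)
    have "reach W F r y" using step.hyps(1) by (simp add: reach_def)
    then have "y \<in> C" "z \<in> C" using step.hyps(2) r reach_step by auto
    then show ?case using step by (intro reach_step[of C _ r y z]) (auto simp: induced_edges_def)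
  qed simp
  then show ?thesis
    using r unfolding connected_graph_def by (auto intro: reach_sym reach_trans)
qed

text \<open>A block that has an edge in a member \<open>T\<close> but leaves \<open>T\<close> would,
  for lack of cut vertices, return to \<open>T\<close> at another vertex. This closes a cycle that
  is not in the partition. So the block is contained in a member and equals it by
  maximality.\<close>

lemma block_is_triangle:
  assumes part: "triangle_partition F \<T>" and simple: "simple_graph W F"
    and cycles: "\<And>c. graph_cycle F c \<Longrightarrow> set c \<in> \<T>"
    and C: "C \<in> components W F" and ne: "induced_edges F C \<noteq> {}"
    and block: "block C (induced_edges F C) B K"
  shows "is_triangle B K"
proof -
  let ?I = "induced_edges F C"
  have b: "subgraph B K C ?I" "connected_graph B K" "\<And>x. \<not> cut_vertex B K x"
    and max: "\<And>B' K'. subgraph B' K' C ?I \<Longrightarrow> connected_graph B' K' \<Longrightarrow> \<forall>x. \<not> cut_vertex B' K' x \<Longrightarrow>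
        B \<subseteq> B' \<Longrightarrow> K \<subseteq> K' \<Longrightarrow> B' = B \<and> K' = K"
    using block unfolding block_def by blast+
  have KF: "K \<subseteq> F" "B \<subseteq> C" "\<And>e. e \<in> K \<Longrightarrow> e \<subseteq> B" "K \<subseteq> all_pairs B"
    using b(1) simple unfolding subgraph_def induced_edges_def simple_graph_def by (auto simp: in_all_pairs_iff)
  \<comment> \<open>A member meeting \<open>C\<close> lies in \<open>C\<close> altogether and is
    connected without cut vertices, hence a candidate in the maximality of the block.\<close>
  have absorb: "B = T \<and> K = all_pairs T" if T: "T \<in> \<T>" "B \<subseteq> T" "r \<in> T" "r \<in> C" for T r
  proof -
    have TF: "all_pairs T \<subseteq> F" using part T unfolding triangle_partition_def by blast
    have TC: "T \<subseteq> C"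
    proof
      fix y assume "y \<in> T"
      show "y \<in> C"
      proof (cases "y = r")
        case False
        then have e: "{r, y} \<in> F" using T \<open>y \<in> T\<close> TF False doubleton_in_all_pairs[of r y T] by blast
        then have "y \<in> W" using simple unfolding simple_graph_def by blast
        then show ?thesis using component_edge[OF C e] T by blast
      qed (use T in simp)
    qed
    have "subgraph T (all_pairs T) C ?I"
    proof -
      have "e \<subseteq> T" if "e \<in> all_pairs T" for e using that by (simp add: in_all_pairs_iff)
      then show ?thesis using TC TF unfolding subgraph_def induced_edges_def by blast
    qed
    moreover have "K \<subseteq> all_pairs T"
    proof
      fix e assume "e \<in> K"
      then have "e \<in> all_pairs B" using KF(4) by blast
      then show "e \<in> all_pairs T" using T(2) by (auto simp: in_all_pairs_iff)
    qed
    moreover have "connected_graph T (all_pairs T)" using T(3) by (intro connected_all_pairs) blast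
    ultimately have "T = B \<and> all_pairs T = K"
      using T(2) by (intro max) (simp_all add: no_cut_vertex_all_pairs)
    then show ?thesis by blast
  qed
  have in_T: "\<exists>T\<in>\<T>. x \<in> T \<and> y \<in> T \<and> x \<noteq> y" if "{x, y} \<in> F" for x y
  proof -
    have "{x, y} \<in> \<Union> (all_pairs ` \<T>)" using that part unfolding triangle_partition_def by simp
    then show ?thesis by (auto simp: doubleton_in_all_pairs)
  qed
  have "\<exists>T\<in>\<T>. \<exists>r. r \<in> T \<and> r \<in> C \<and> B \<subseteq> T"
  proof (cases "K = {}")
    case True
    obtain r where r: "r \<in> B" using b(2) unfolding connected_graph_def by blast
    have B: "B = {r}"
    proof (rule ccontr)
      assume "B \<noteq> {r}"
      then obtain w where "w \<in> B" "w \<noteq> r" using r by blast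
      then show False using reach_exit[of B K r w "{r}"] b(2) r True unfolding connected_graph_def by blast
    qed
    obtain e where "e \<in> ?I" using ne by blast
    then obtain s t where st: "{s, t} \<in> F" "s \<in> C" "t \<in> C" "s \<noteq> t"
      using simple_graphE[OF simple] unfolding induced_edges_def by (metis (no_types, lifting) insert_subset mem_Collect_eq)
    \<comment> \<open>For a block reduced to the vertex \<open>r\<close>: the component has an edge,
      so \<open>r\<close> has a neighbour and lies in some member, to which \<open>absorb\<close>
      applies.\<close>
    have "\<exists>y. {r, y} \<in> F"
    proof (cases "r = s")
      case False
      have "reach C ?I r s"
        using component_connected[OF C] st r KF(2) unfolding connected_graph_def by blast
      then show ?thesis
        using reach_exit[of C ?I r s "{r}"] False unfolding induced_edges_def by blast
    qed (use st in blast)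
    then show ?thesis using in_T B r KF(2) by blast
  next
    case False
    then obtain e where e: "e \<in> K" by blast
    then have "e \<in> all_pairs B" using KF(4) by blast
    then obtain x y where xy: "{x, y} \<in> K" "x \<noteq> y" "x \<in> B" "y \<in> B"
      using e unfolding all_pairs_def by blast
    then obtain T where T: "T \<in> \<T>" "x \<in> T" "y \<in> T" using in_T KF(1) by blast
    have "B \<subseteq> T"
    proof
      fix w assume w: "w \<in> B"
      show "w \<in> T"
      proof (rule ccontr)
        assume "w \<notin> T"
        moreover have "reach B K x w" using b(2) xy w unfolding connected_graph_def by blast
        ultimately obtain a b' where ab: "a \<in> T" "a \<in> B" "b' \<in> B" "b' \<notin> T" "{a, b'} \<in> K"
          using reach_exit[of B K x w T] T by blast
        \<comment> \<open>The block contains two vertices \<open>x\<close>, \<open>y\<close> of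
          \<open>T\<close>, so one of them differs from the exit vertex \<open>a\<close>.\<close>
        obtain a' where a': "a' \<in> T" "a' \<in> B" "a' \<noteq> a" using xy T by blast
        have "reach (B - {a}) {e\<in>K. a \<notin> e} b' a'"
          using b(3)[of a] ab a' unfolding cut_vertex_def by blast
        moreover have "b' \<in> B - {a}" using ab by blast
        ultimately have "\<exists>xs. adj_walk {e\<in>K. a \<notin> e} xs \<and> distinct xs \<and> xs \<noteq> [] \<and> hd xs = b' \<and>
          last xs = a' \<and> set xs \<subseteq> B - {a}"
          by (rule reach_path)
        then obtain xs where xs: "adj_walk {e\<in>K. a \<notin> e} xs" "distinct xs" "xs \<noteq> []" "hd xs = b'"
          "last xs = a'" "set xs \<subseteq> B - {a}"
          by blast
        have "\<exists>d\<in>set xs. d \<in> T" using last_in_set[OF xs(3)] xs(5) a'(1) by blast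
        \<comment> \<open>Stopping at the first return \<open>d\<close> to \<open>T\<close> keeps
          all of \<open>us\<close> outside \<open>T\<close>. The edge from \<open>d\<close> to
          \<open>a\<close> inside \<open>T\<close> then closes the cycle.\<close>
        then obtain us d ws where us: "xs = us @ d # ws" "d \<in> T" "\<forall>u\<in>set us. u \<notin> T"
          using split_list_first_prop[of xs "\<lambda>d. d \<in> T"] by blast
        have "us \<noteq> []" using us xs ab by auto
        have "adj_walk F xs" by (rule adj_walk_mono[OF xs(1)]) (use KF(1) in blast)
        moreover have "a \<noteq> d" "a \<notin> set us" using us(1) xs(6) by auto
        moreover have "{d, a} \<in> F" using triangle_partition_edge[OF part T(1) us(2) ab(1)] \<open>a \<noteq> d\<close> by blast
        moreover have "{a, hd us} \<in> F" using xs(4) us \<open>us \<noteq> []\<close> ab KF(1) by auto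
        ultimately have "graph_cycle F (a # us @ [d])"
          using \<open>us \<noteq> []\<close> xs(2) us unfolding graph_cycle_Cons
          by (auto simp: adj_walk_Cons adj_walk_append hd_append Suc_le_eq split: if_splits)
        then have "set (a # us @ [d]) \<in> \<T>" by (rule cycles)
        then have "set (a # us @ [d]) = T"
          by (rule triangle_partition_unique[OF part _ T(1), of _ a d]) (use ab us \<open>a \<noteq> d\<close> in auto)
        then show False using us(3) \<open>us \<noteq> []\<close> by (cases us) auto
      qed
    qed
    then show ?thesis using T xy KF(2) by blast
  qed
  then obtain T r where "T \<in> \<T>" "r \<in> T" "r \<in> C" "B \<subseteq> T" by blast
  then show ?thesis
    using absorb[of T r] part unfolding triangle_partition_def is_triangle_def all_pairs_def by blast
qed

lemma triangles_eq_members: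
  assumes part: "triangle_partition F \<T>" and simple: "simple_graph W F"
    and cycles: "\<And>c. graph_cycle F c \<Longrightarrow> set c \<in> \<T>"
  shows "triangles W F = \<T>"
proof
  show "triangles W F \<subseteq> \<T>"
  proof
    fix T assume T: "T \<in> triangles W F"
    then obtain x y z where xyz: "T = {x, y, z}" "distinct [x, y, z]"
      by (auto simp: triangles_def card_3_iff)
    then have "{x, y} \<in> F" "{y, z} \<in> F" "{z, x} \<in> F" using T by (auto simp: triangles_def)
    then have "graph_cycle F [x, y, z]" using xyz by (auto simp: graph_cycle_Cons)
    then have "set [x, y, z] \<in> \<T>" by (rule cycles)
    then show "T \<in> \<T>" using xyz by simp
  qed
  show "\<T> \<subseteq> triangles W F"
  proof
    fix T assume T: "T \<in> \<T>"
    then have card: "card T = 3" and "all_pairs T \<subseteq> F"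
      using part unfolding triangle_partition_def by blast+
    then have edges: "{x, y} \<in> F" if "x \<in> T" "y \<in> T" "x \<noteq> y" for x y
      using that doubleton_in_all_pairs[of x y T] by blast
    have "T \<subseteq> W"
    proof
      fix x assume x: "x \<in> T"
      have "T \<noteq> {x}" using card by auto
      then obtain y where "y \<in> T" "x \<noteq> y" using x by blast
      then have "{x, y} \<in> F" using edges x by blast
      then show "x \<in> W" using simple unfolding simple_graph_def by blast
    qed
    then show "T \<in> triangles W F" using card edges unfolding triangles_def by blast
  qed
qed

text \<open>Each edge extends to a block, which is a triangle, so triangles cover the edges. Two
  triangles with a common edge have a union without cut vertex; the block around it has only three
  vertices, which makes the two equal.\<close>

lemma triangles_partition_if_cacti:
  assumes simple: "simple_graph W F" and cacti: "nontrivial_components_triangle_cacti W F"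
  shows "triangle_partition F (triangles W F)"
proof -
  have fin: "finite W" using simple_graph_finite[OF simple] by blast
  have block: "card B = 3 \<and> K = all_pairs B"
    if "C \<in> components W F" "induced_edges F C \<noteq> {}" "block C (induced_edges F C) B K" for C B K
  proof -
    have "is_triangle B K"
      using cacti that unfolding nontrivial_components_triangle_cacti_def triangle_cactus_def by blast
    then show ?thesis by (simp add: is_triangle_def all_pairs_def)
  qed
  have simpleC: "simple_graph C (induced_edges F C)" if "C \<in> components W F" for C
    using simple_graph_induced[OF simple component_subset[OF that]] .
  have comp: "\<exists>C\<in>components W F. x \<in> C" if "x \<in> W" for x
    using that unfolding components_def by (intro bexI[of _ "{y\<in>W. reach W F x y}"]) auto
  have tri_pairs: "all_pairs T \<subseteq> F" if "T \<in> triangles W F" for T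
    using that by (auto simp: triangles_def all_pairs_def)
  have covered: "\<exists>T\<in>triangles W F. e \<in> all_pairs T" if e: "e \<in> F" for e
  proof -
    obtain x y where xy: "e = {x, y}" "x \<noteq> y" "x \<in> W" "y \<in> W" using simple_graphE[OF simple e] .
    obtain C where C: "C \<in> components W F" "x \<in> C" using comp xy by blast
    then have "y \<in> C" using component_edge[OF C(1) _ C(2) xy(4)] e xy(1) by simp
    then have eI: "e \<in> induced_edges F C" using e xy C by (auto simp: induced_edges_def)
    \<comment> \<open>Viewed as a complete graph on two vertices, the edge is connected without cut
      vertices and can be extended to a block.\<close>
    have pe: "all_pairs e = {e}"
      unfolding xy all_pairs_def using xy(2) by auto
    have "subgraph e (all_pairs e) C (induced_edges F C)"
      unfolding pe using eI by (auto simp: subgraph_def induced_edges_def)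
    then obtain B K where BK: "block C (induced_edges F C) B K" "e \<subseteq> B" "all_pairs e \<subseteq> K"
      using extend_to_block[OF simpleC[OF C(1)] _ connected_all_pairs[of e] no_cut_vertex_all_pairs] xy(1)
      by blast
    then have B: "card B = 3" "K = all_pairs B" using block C(1) eI by blast+
    have sub: "subgraph B K C (induced_edges F C)" using BK(1) by (simp add: block_def)
    have "B \<subseteq> W" using sub component_subset[OF C(1)] by (auto simp: subgraph_def)
    moreover have "{x, y} \<in> F" if "x \<in> B" "y \<in> B" "x \<noteq> y" for x y
    proof -
      have "{x, y} \<in> K" using that B(2) by (simp add: doubleton_in_all_pairs)
      then show ?thesis using sub by (auto simp: subgraph_def induced_edges_def)
    qed
    ultimately have "B \<in> triangles W F" using B(1) unfolding triangles_def by blast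
    then show ?thesis using BK(3) pe B by blast
  qed
  have unique: "S = T"
    if S: "S \<in> triangles W F" and T: "T \<in> triangles W F" and e: "card e = 2" "e \<subseteq> S" "e \<subseteq> T" for S T e
  proof (rule ccontr)
    assume "S \<noteq> T"
    have card: "card S = 3" "card T = 3" "S \<subseteq> W" "T \<subseteq> W" using S T by (auto simp: triangles_def)
    obtain x y where xy: "e = {x, y}" "x \<noteq> y" using e(1) by (auto simp: card_2_iff)
    have "x \<in> W" using e(2) xy(1) card(3) by auto
    then obtain C where C: "C \<in> components W F" "x \<in> C" using comp by blast
    have inC: "U \<subseteq> C" if "U \<in> triangles W F" "x \<in> U" for U
    proof
      fix z assume z: "z \<in> U"
      show "z \<in> C"
      proof (cases "z = x")
        case False
        then have "{x, z} \<in> F" "z \<in> W" using that z by (auto simp: triangles_def)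
        then show ?thesis using component_edge[OF C(1) _ C(2)] by blast
      qed (use C in simp)
    qed
    have ST: "S \<subseteq> C" "T \<subseteq> C" using inC[OF S] inC[OF T] e(2,3) xy(1) by blast+
    have sub: "subgraph (S \<union> T) (all_pairs S \<union> all_pairs T) C (induced_edges F C)"
    proof -
      have "f \<subseteq> S \<union> T" if "f \<in> all_pairs S \<union> all_pairs T" for f
        using that by (auto simp: in_all_pairs_iff)
      then show ?thesis
        using ST tri_pairs[OF S] tri_pairs[OF T] unfolding subgraph_def induced_edges_def by blast
    qed
    have mem: "x \<in> S \<inter> T" "y \<in> S \<inter> T" using e xy by auto
    obtain B K where BK: "block C (induced_edges F C) B K" "S \<union> T \<subseteq> B" "all_pairs S \<union> all_pairs T \<subseteq> K"
      using extend_to_block[OF simpleC[OF C(1)] sub connected_all_pairs_Un[OF mem(1)]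
          no_cut_vertex_all_pairs_Un[OF mem xy(2)]] by blast
    have "{x, y} \<in> induced_edges F C"
      using sub mem xy(2) unfolding subgraph_def by (auto simp: doubleton_in_all_pairs)
    then have "card B = 3" using block C(1) BK(1) by blast
    then have "finite B" by (auto intro: card_ge_0_finite)
    then have "S = B" "T = B" using BK(2) card \<open>card B = 3\<close> by (metis card_subset_eq le_sup_iff)+
    then show False using \<open>S \<noteq> T\<close> by simp
  qed
  have "finite (triangles W F)"
    using fin by (auto simp: triangles_def intro: finite_subset[of _ "Pow W"])
  moreover have "card T = 3" if "T \<in> triangles W F" for T using that by (simp add: triangles_def)
  moreover have "F = \<Union> (all_pairs ` triangles W F)" using covered tri_pairs by blast
  ultimately show ?thesis unfolding triangle_partition_def using unique by blast
qed

section \<open>The dominating vertex and the final count\<close>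

lemma edges_at_dominating_vertex:
  assumes "simple_graph V E" "v \<in> V" "\<forall>u\<in>V - {v}. {u, v} \<in> E"
  shows "E = delete_vertex_edges E v \<union> star v (V - {v})"
    "card E = card (delete_vertex_edges E v) + (card V - 1)"
    "simple_graph (V - {v}) (delete_vertex_edges E v)"
proof -
  have fin: "finite V" "finite E" using simple_graph_finite[OF assms(1)] by auto
  show E: "E = delete_vertex_edges E v \<union> star v (V - {v})"
  proof
    show "E \<subseteq> delete_vertex_edges E v \<union> star v (V - {v})"
    proof
      fix e assume "e \<in> E"
      moreover then obtain x y where "e = {x, y}" "x \<noteq> y" "x \<in> V" "y \<in> V"
        using simple_graphE[OF assms(1)] by metis
      ultimately show "e \<in> delete_vertex_edges E v \<union> star v (V - {v})"
        by (auto simp: delete_vertex_edges_def star_def)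
    qed
    show "delete_vertex_edges E v \<union> star v (V - {v}) \<subseteq> E"
      using assms(3) by (auto simp: delete_vertex_edges_def star_def insert_commute)
  qed
  have "inj_on (\<lambda>x. {v, x}) (V - {v})" by (auto simp: inj_on_def doubleton_eq_iff)
  then have "card (star v (V - {v})) = card V - 1"
    unfolding star_def using assms(2) fin by (simp add: card_image)
  moreover have "delete_vertex_edges E v \<inter> star v (V - {v}) = {}"
    by (auto simp: delete_vertex_edges_def star_def)
  moreover have "finite (delete_vertex_edges E v)" "finite (star v (V - {v}))"
    using fin by (auto simp: delete_vertex_edges_def star_def)
  ultimately show "card E = card (delete_vertex_edges E v) + (card V - 1)"
    using card_Un_disjoint E by metis
  show "simple_graph (V - {v}) (delete_vertex_edges E v)"
    using assms(1) by (auto simp: simple_graph_def delete_vertex_edges_def)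
qed

lemma dominating_vertex_if_max_degree:
  assumes "simple_graph V E" "V \<noteq> {}" "max_degree V E = card V - 1"
  obtains v where "v \<in> V" "\<forall>u\<in>V - {v}. {u, v} \<in> E"
proof -
  have fin: "finite V" using simple_graph_finite[OF assms(1)] by blast
  then have "Max (degree V E ` V) \<in> degree V E ` V" using assms(2) by (intro Max_in) auto
  then obtain v where v: "v \<in> V" "degree V E v = card V - 1"
    using assms(3) unfolding max_degree_def by auto
  have "{v, v} \<notin> E" using assms(1) by (auto simp: simple_graph_def)
  then have sub: "{u\<in>V. {u, v} \<in> E} \<subseteq> V - {v}" by auto
  have "card {u\<in>V. {u, v} \<in> E} = card (V - {v})"
    using v fin unfolding degree_def by simp
  then have "{u\<in>V. {u, v} \<in> E} = V - {v}" using sub fin by (intro card_subset_eq) auto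
  then show thesis using that[OF v(1)] by blast
qed

theorem theorem1p1:
  fixes V :: "'a set" and E :: "'a set set" and k :: nat
  assumes "k \<ge> 1"
    and "simple_graph V E"
    and "V \<noteq> {}"
    and "planar V E"
    and "max_degree V E = card V - 1"
    and "\<not> has_k_edge_disjoint_cycles V E k"
  shows "int (card E) \<le> int (card V) + 3 * int k - 4 \<and>
         (int (card E) = int (card V) + 3 * int k - 4 \<longleftrightarrow>
           (\<exists>v\<in>V. (\<forall>u\<in>V - {v}. {u, v} \<in> E) \<and>
              num_triangles (V - {v}) (delete_vertex_edges E v) = k - 1 \<and>
              nontrivial_components_triangle_cacti (V - {v}) (delete_vertex_edges E v)))"
proof -
  have "finite V" using simple_graph_finite[OF assms(2)] by blast
  then have n: "1 \<le> card V" using assms(3) by (simp add: Suc_le_eq card_gt_0_iff)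
  have no_packs: "\<not> packs E k" using has_k_edge_disjoint_cycles_if_packs assms(2,6) by blast
  obtain v where v: "v \<in> V" "\<forall>u\<in>V - {v}. {u, v} \<in> E"
    using dominating_vertex_if_max_degree[OF assms(2,3,5)] .
  define W F where "W = V - {v}" and "F = delete_vertex_edges E v"
  have E: "E = F \<union> star v W" "card E = card F + (card V - 1)" and simple: "simple_graph W F"
    using edges_at_dominating_vertex[OF assms(2) v] by (simp_all add: W_def F_def)
  have vW: "v \<notin> W" by (simp add: W_def)
  have "theta_free F"
    unfolding F_def delete_vertex_edges_def
    using assms(2) v by (intro theta_free_if_planar_apex[OF assms(4)]) (auto simp: simple_graph_def)
  then have bound: "card F \<le> 3 * (k - 1)"
    and extremal: "card F = 3 * (k - 1) \<longrightarrow> (\<exists>\<T>. triangle_partition F \<T> \<and> card \<T> = k - 1)"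
    using card_edges_le_if_no_packing[OF simple _ vW _ assms(1)] no_packs E(1) by simp_all
  \<comment> \<open>Neither subtraction on the right truncates, as \<open>k\<close> and
    \<open>card V\<close> are positive.\<close>
  have eq_iff: "int (card E) = int (card V) + 3 * int k - 4 \<longleftrightarrow> card E = 3 * (k - 1) + (card V - 1)"
    using n assms(1) by linarith
  show ?thesis
  proof (intro conjI iffI)
    show "int (card E) \<le> int (card V) + 3 * int k - 4"
      using bound E(2) n assms(1) by linarith
  next
    assume "int (card E) = int (card V) + 3 * int k - 4"
    then have "card F = 3 * (k - 1)" using E(2) unfolding eq_iff by linarith
    then obtain \<T> where T: "triangle_partition F \<T>" "card \<T> = k - 1" using extremal by blast
    \<comment> \<open>Since \<open>k \<ge> 1\<close>, the number \<open>Suc (card \<T>)\<close> is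
      exactly \<open>k\<close>.\<close>
    then have "\<not> packs (F \<union> star v W) (Suc (card \<T>))" using no_packs E(1) assms(1) by simp
    then have cycles: "set c \<in> \<T>" if "graph_cycle F c" for c
      using graph_cycle_is_member[OF T(1) simple vW] that by blast
    have "num_triangles W F = k - 1"
      unfolding num_triangles_def using triangles_eq_members[OF T(1) simple cycles] T(2) by simp
    moreover have "nontrivial_components_triangle_cacti W F"
      unfolding nontrivial_components_triangle_cacti_def triangle_cactus_def
      using component_connected block_is_triangle[OF T(1) simple cycles] by blast
    ultimately show "\<exists>v\<in>V. (\<forall>u\<in>V - {v}. {u, v} \<in> E) \<and>
        num_triangles (V - {v}) (delete_vertex_edges E v) = k - 1 \<and>
        nontrivial_components_triangle_cacti (V - {v}) (delete_vertex_edges E v)"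
      using v unfolding W_def F_def by blast
  next
    assume "\<exists>v\<in>V. (\<forall>u\<in>V - {v}. {u, v} \<in> E) \<and>
        num_triangles (V - {v}) (delete_vertex_edges E v) = k - 1 \<and>
        nontrivial_components_triangle_cacti (V - {v}) (delete_vertex_edges E v)"
    \<comment> \<open>The given vertex \<open>w\<close> may differ from \<open>v\<close>, so the
      edges are counted afresh at \<open>w\<close>.\<close>
    then obtain w where w: "w \<in> V" "\<forall>u\<in>V - {w}. {u, w} \<in> E"
      "num_triangles (V - {w}) (delete_vertex_edges E w) = k - 1"
      "nontrivial_components_triangle_cacti (V - {w}) (delete_vertex_edges E w)" by blast
    note split = edges_at_dominating_vertex[OF assms(2) w(1,2)]
    have "card (delete_vertex_edges E w) = 3 * (k - 1)"
      using triangle_partition_card[OF triangles_partition_if_cacti[OF split(3) w(4)]] w(3)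
      unfolding num_triangles_def by simp
    then show "int (card E) = int (card V) + 3 * int k - 4"
      using split(2) unfolding eq_iff by linarith
  qed
qed

end
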